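(* The ascending-price auction described in the context is locally strategy-proof (also with the waiting option). In particular, for every player, it is locally dominant to bid ($b$) as long as the price is below her valuation and then leave ($\ell$) when the price reaches her valuation.
   Context: Framework. A finite multistage game has a finite player set $I$. First, nature chooses $\theta$ from a finite set $\Theta$; then there are exactly $T$ stages, and at each stage all players simultaneously choose an action. $A_i$ is the finite action set of player $i$ and $A=\times_{i\in I}A_i$. The set of stage-$1$ histories is $X^1=\Theta$; for $t=2,\dots,T$ the set of stage-$t$ histories is $X^t\subseteq\Theta\times A^{t-1}$; the set of terminal histories is $Z\subseteq\Theta\times A^{T}$. Let $X=\cup_{t=1}^T X^t$; $X\cup Z$ is ordered by the "prefix of" relation $\prec$. Each player $i$ has a partition $H_i$ of $X$ into information sets, each containing only histories of the same stage that $i$ cannot distinguish; $\tau(h)$ is the stage of $h$. $H_i$ satisfies perfect recall and inherits the order $\prec$. At each $h\in H_i$ a set $A_i^h\subseteq A_i$ of actions is available. Player $i$ is active at $h$ if $|A_i^h|>1$ (otherwise her only action is a dummy action); $H_i^{\ast}$ is the set of $h\in H_i$ where $i$ is active. Each player $i$ has an outcome function $g_i:Z\to Y_i$ and a payoff function $u_i:Z\to\mathbb{R}$. Strategies. A (reduced) strategy $s_i$ of player $i$ assigns an action in $A_i^h$ to each $h\in H_i$ that can be reached given the actions assigned by $s_i$ to the previous information sets of $i$. $S_i$ is the set of strategies of $i$, and $S_{-i}=\Theta\times(\times_{j\ne i}S_j)$ (nature's move is included). $\zeta(s_i,s_{-i})\in Z$ is the terminal history induced by $(s_i,s_{-i})$.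 For $h\in H_i$, $S_i(h)$ and $S_{-i}(h)$ are the sets of elements of $S_i$ and $S_{-i}$ that allow $h$ to be reached. For $a_i\in A_i^h$, $S_i(h,a_i)=\{s_i\in S_i(h): s_i(h)=a_i\}$. For $s_{-i}\in S_{-i}(h)$, $Z(h,a_i,s_{-i})=\{\zeta(s_i,s_{-i}): s_i\in S_i(h,a_i)\}$. Local partition. For $h\in H_i^\ast$ and $a_i\in A_i^h$ let $S_{-i}^{a_i,h}=\{s_{-i}\in S_{-i}(h):$ for all $z\in Z(h,a_i,s_{-i})$ there is no $h'\in H_i^{\ast}$ with $h\prec h'\prec z\}$. For $\overline{a}_i,a_i\in A_i^h$ let $S^{\overline{a}_i,a_i}(h)=S_{-i}^{a_i,h}\cap S_{-i}^{\overline{a}_i,h}$, $S^{\overline{a}_i}_{a_i}(h)=S_{-i}^{\overline{a}_i,h}\setminus S_{-i}^{a_i,h}$, $S^{a_i}_{\overline{a}_i}(h)=S_{-i}^{a_i,h}\setminus S_{-i}^{\overline{a}_i,h}$, $S_{\overline{a}_i,a_i}(h)=S_{-i}(h)\setminus(S_{-i}^{\overline{a}_i,h}\cup S_{-i}^{a_i,h})$, and let $\mathcal{S}^{\ell}(h,\overline{a}_i,a_i)$ be the collection of these four sets. Mimicking. $\mathcal{H}^{\ast}(h,a_i)$ is the set of the first active information sets of $i$ after choosing $a_i$ at $h$. For $\overline{s}_i,s_i\in S_i(h)$ and $\overline{S}_{-i}\subseteq S_{-i}(h)$, $\overline{s}_i$ mimics $s_i$ given $h$ and $\overline{S}_{-i}$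 if for every $s_{-i}\in\overline{S}_{-i}$, every $\overline{h}\in\mathcal{H}^{\ast}(h,\overline{s}_i(h))$ and all $\overline{h}',h'\in H_i$ with $\overline{h}\preceq\overline{h}'\prec\zeta(\overline{s}_i,s_{-i})$, $h'\prec\zeta(s_i,s_{-i})$ and $\tau(\overline{h}')=\tau(h')$, we have $\overline{s}_i(\overline{h}')=s_i(h')$. Local dominance. At $h\in H_i^{\ast}$, action $\overline{a}_i$ locally dominates $a_i$ if for each nonempty $\overline{S}_{-i}\in\mathcal{S}^{\ell}(h,\overline{a}_i,a_i)$ and each $s_i\in S_i(h,a_i)$ there is $\overline{s}_i\in S_i(h,\overline{a}_i)$ that mimics $s_i$ given $h$ and $\overline{S}_{-i}$ such that: if $\overline{S}_{-i}\ne S_{\overline{a}_i,a_i}(h)$, $\min_{s_{-i}\in\overline{S}_{-i}}u_i(\zeta(\overline{s}_i,s_{-i}))\ge\max_{s_{-i}\in\overline{S}_{-i}}u_i(\zeta(s_i,s_{-i}))$; if $\overline{S}_{-i}=S_{\overline{a}_i,a_i}(h)$, $g_i(\zeta(\overline{s}_i,s_{-i}))=g_i(\zeta(s_i,s_{-i}))$ for all $s_{-i}\in\overline{S}_{-i}$. An action is locally dominant at $h$ if it locally dominates every other action in $A_i^h$. A game is locally strategy-proof if each player has a locally dominant action at every active information set that can be reached if she always chooses her locally dominant actions. The auction. There are $n$ bidders with private valuations for a single object, which are assumed to be integer (the profile of valuations is nature's move, and each bidder observes her own). At each stage $t=1,\dots,T$, with $T$ larger than any possible valuation, the price is $t$ and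 players only observe whether the object was already assigned or not; if not, the players who have not left before simultaneously choose between bid ($b$) and leave ($\ell$); in the variant with the waiting option they can also wait ($w$). Players who left before stage $t$ are forced to play $\ell$, and all players must play $\ell$ once the object is assigned. Stage-$t$ outcome rule: if no player bids, the object is assigned at random at price $t$ among the bidders who have not left before stage $t$; if only one player bids, she wins the object at price $t$; if more than one player bids, the auction moves to stage $t+1$. If waiting is allowed, the stage-$t$ outcome rule makes no distinction between waiting and leaving; the only difference between them is that, if the auction continues, a player who waited can move at the next stages, while a player who left must play $\ell$ forever. A bidder's payoff is her surplus: valuation minus price if she wins the object, $0$ if she does not get it; the random assignment is a lottery giving her the object at the current price with some probability, whose payoff to her lies between that of winning at that price for sure and that of not getting the object.
   Formalization: Valuations are assumed to be at least 1 when waiting is allowed, and there are at least two stages; with waiting and valuation 0 (or with T = 1) neither leaving, waiting nor bidding need be locally dominant at price 1. *)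

theory Defs
  imports Complex_Main "HOL-Library.FuncSet" "HOL-Library.Sublist"
begin

section \<open>Finite multistage games\<close>

text \<open>A history is nature's move together with the list of action profiles chosen so far, so a
  stage-\<open>t\<close> history carries \<open>t - 1\<close> profiles.  The player set is the finite type \<open>'i\<close>.\<close>

type_synonym ('i, 'th, 'a) hist = "'th \<times> ('i \<Rightarrow> 'a) list"

record ('i, 'th, 'a, 'y) game =
  nature  :: "'th set"
  horizon :: nat
  avail   :: "'i \<Rightarrow> ('i, 'th, 'a) hist \<Rightarrow> 'a set"
  indist  :: "'i \<Rightarrow> ('i, 'th, 'a) hist \<Rightarrow> ('i, 'th, 'a) hist \<Rightarrow> bool"
  outcome :: "'i \<Rightarrow> ('i, 'th, 'a) hist \<Rightarrow> 'y"
  payoff  :: "'i \<Rightarrow> ('i, 'th, 'a) hist \<Rightarrow> real"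

definition stage :: "('i, 'th, 'a) hist \<Rightarrow> nat" where
  "stage x = Suc (length (snd x))"

definition hist_less :: "('i, 'th, 'a) hist \<Rightarrow> ('i, 'th, 'a) hist \<Rightarrow> bool" where
  "hist_less x y \<longleftrightarrow> fst x = fst y \<and> strict_prefix (snd x) (snd y)"

definition trunc :: "nat \<Rightarrow> ('i, 'th, 'a) hist \<Rightarrow> ('i, 'th, 'a) hist" where
  "trunc k x = (fst x, take k (snd x))"

text \<open>\<open>hists_at G k\<close> is $X^{k+1}$ for \<open>k < horizon G\<close>, and $Z$ for \<open>k = horizon G\<close>.\<close>

fun hists_at :: "('i, 'th, 'a, 'y) game \<Rightarrow> nat \<Rightarrow> ('i, 'th, 'a) hist set" where
  "hists_at G 0 = {(\<theta>, []) | \<theta>. \<theta> \<in> nature G}"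
| "hists_at G (Suc k) =
     {(\<theta>, as @ [a]) | \<theta> as a. (\<theta>, as) \<in> hists_at G k \<and> (\<forall>i. a i \<in> avail G i (\<theta>, as))}"

definition hists :: "('i, 'th, 'a, 'y) game \<Rightarrow> ('i, 'th, 'a) hist set" where
  "hists G = (\<Union>k<horizon G. hists_at G k)"

definition infoset ::
  "('i, 'th, 'a, 'y) game \<Rightarrow> 'i \<Rightarrow> ('i, 'th, 'a) hist \<Rightarrow> ('i, 'th, 'a) hist set" where
  "infoset G i x = {y \<in> hists G. indist G i x y}"

definition infosets :: "('i, 'th, 'a, 'y) game \<Rightarrow> 'i \<Rightarrow> ('i, 'th, 'a) hist set set" where
  "infosets G i = infoset G i ` hists G"

text \<open>Well-formedness.  The last two lines are perfect recall: indistinguishable histories have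
  indistinguishable truncations and the same own past actions.\<close>

definition multistage_game :: "('i::finite, 'th, 'a, 'y) game \<Rightarrow> bool" where
  "multistage_game G \<longleftrightarrow>
     finite (nature G) \<and> nature G \<noteq> {} \<and> 1 \<le> horizon G \<and>
     (\<forall>i. \<forall>x\<in>hists G. finite (avail G i x) \<and> avail G i x \<noteq> {}) \<and>
     (\<forall>i. equiv (hists G) {(x, y). x \<in> hists G \<and> y \<in> hists G \<and> indist G i x y}) \<and>
     (\<forall>i. \<forall>x\<in>hists G. \<forall>y\<in>hists G. indist G i x y \<longrightarrow>
        stage x = stage y \<and> avail G i x = avail G i y \<and>
        (\<forall>k < length (snd x).
           indist G i (trunc k x) (trunc k y) \<and> (snd x ! k) i = (snd y ! k) i))"

text \<open>In a well-formed game \<open>avail G i\<close> and \<open>stage\<close> are constant on information sets, so the next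
  two notions are just the common value.\<close>

definition acts :: "('i, 'th, 'a, 'y) game \<Rightarrow> 'i \<Rightarrow> ('i, 'th, 'a) hist set \<Rightarrow> 'a set" where
  "acts G i h = (\<Union>x\<in>h. avail G i x)"

definition info_stage :: "('i, 'th, 'a) hist set \<Rightarrow> nat" where
  "info_stage h = the_elem (stage ` h)"

definition active_infosets :: "('i, 'th, 'a, 'y) game \<Rightarrow> 'i \<Rightarrow> ('i, 'th, 'a) hist set set" where
  "active_infosets G i = {h \<in> infosets G i. card (acts G i h) > 1}"

definition info_less :: "('i, 'th, 'a) hist set \<Rightarrow> ('i, 'th, 'a) hist set \<Rightarrow> bool" where
  "info_less h h' \<longleftrightarrow> (\<exists>x\<in>h. \<exists>y\<in>h'. hist_less x y)"

definition info_le :: "('i, 'th, 'a) hist set \<Rightarrow> ('i, 'th, 'a) hist set \<Rightarrow> bool" where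
  "info_le h h' \<longleftrightarrow> h = h' \<or> info_less h h'"

definition passes :: "('i, 'th, 'a) hist set \<Rightarrow> ('i, 'th, 'a) hist \<Rightarrow> bool" where
  "passes h z \<longleftrightarrow> (\<exists>x\<in>h. hist_less x z)"

section \<open>Reduced strategies\<close>

text \<open>A reduced strategy is a partial map defined exactly at the information sets that are
  consistent with its own prescriptions at the earlier ones.\<close>

type_synonym ('i, 'th, 'a) strategy = "('i, 'th, 'a) hist set \<rightharpoonup> 'a"

definition consistent ::
  "('i, 'th, 'a, 'y) game \<Rightarrow> 'i \<Rightarrow> ('i, 'th, 'a) strategy \<Rightarrow> ('i, 'th, 'a) hist \<Rightarrow> bool" where
  "consistent G i s x \<longleftrightarrow>
     (\<forall>k < length (snd x). s (infoset G i (trunc k x)) = Some ((snd x ! k) i))"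

definition strategies :: "('i, 'th, 'a, 'y) game \<Rightarrow> 'i \<Rightarrow> ('i, 'th, 'a) strategy set" where
  "strategies G i =
     {s. dom s = {h \<in> infosets G i. \<exists>x\<in>h. consistent G i s x} \<and>
         (\<forall>h\<in>dom s. the (s h) \<in> acts G i h)}"

text \<open>$S_{-i}$: nature's move together with the strategies of the players other than \<open>i\<close>.\<close>

type_synonym ('i, 'th, 'a) opponents = "'th \<times> ('i \<Rightarrow> ('i, 'th, 'a) strategy)"

definition opp_strategies :: "('i, 'th, 'a, 'y) game \<Rightarrow> 'i \<Rightarrow> ('i, 'th, 'a) opponents set" where
  "opp_strategies G i = nature G \<times> PiE (- {i}) (strategies G)"

fun path ::
  "('i, 'th, 'a, 'y) game \<Rightarrow> 'th \<Rightarrow> ('i \<Rightarrow> ('i, 'th, 'a) strategy) \<Rightarrow> nat \<Rightarrow> ('i, 'th, 'a) hist" where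
  "path G \<theta> \<sigma> 0 = (\<theta>, [])"
| "path G \<theta> \<sigma> (Suc k) =
     (\<theta>, snd (path G \<theta> \<sigma> k) @ [\<lambda>j. the (\<sigma> j (infoset G j (path G \<theta> \<sigma> k)))])"

definition zeta ::
  "('i, 'th, 'a, 'y) game \<Rightarrow> 'i \<Rightarrow> ('i, 'th, 'a) strategy \<Rightarrow> ('i, 'th, 'a) opponents
     \<Rightarrow> ('i, 'th, 'a) hist" where
  "zeta G i s r = path G (fst r) ((snd r)(i := s)) (horizon G)"

definition strategies_allowing ::
  "('i, 'th, 'a, 'y) game \<Rightarrow> 'i \<Rightarrow> ('i, 'th, 'a) hist set \<Rightarrow> ('i, 'th, 'a) strategy set" where
  "strategies_allowing G i h =
     {s \<in> strategies G i. \<exists>r\<in>opp_strategies G i. passes h (zeta G i s r)}"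

definition opp_allowing ::
  "('i, 'th, 'a, 'y) game \<Rightarrow> 'i \<Rightarrow> ('i, 'th, 'a) hist set \<Rightarrow> ('i, 'th, 'a) opponents set" where
  "opp_allowing G i h =
     {r \<in> opp_strategies G i. \<exists>s\<in>strategies G i. passes h (zeta G i s r)}"

definition strategies_choosing ::
  "('i, 'th, 'a, 'y) game \<Rightarrow> 'i \<Rightarrow> ('i, 'th, 'a) hist set \<Rightarrow> 'a \<Rightarrow> ('i, 'th, 'a) strategy set" where
  "strategies_choosing G i h a = {s \<in> strategies_allowing G i h. s h = Some a}"

definition outcomes_after ::
  "('i, 'th, 'a, 'y) game \<Rightarrow> 'i \<Rightarrow> ('i, 'th, 'a) hist set \<Rightarrow> 'a \<Rightarrow> ('i, 'th, 'a) opponents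
     \<Rightarrow> ('i, 'th, 'a) hist set" where
  "outcomes_after G i h a r = (\<lambda>s. zeta G i s r) ` strategies_choosing G i h a"

section \<open>Local dominance\<close>

text \<open>\<open>opp_ending G i h a\<close> is $S_{-i}^{a,h}$.\<close>

definition opp_ending ::
  "('i, 'th, 'a, 'y) game \<Rightarrow> 'i \<Rightarrow> ('i, 'th, 'a) hist set \<Rightarrow> 'a \<Rightarrow> ('i, 'th, 'a) opponents set" where
  "opp_ending G i h a =
     {r \<in> opp_allowing G i h. \<forall>z\<in>outcomes_after G i h a r.
        \<not> (\<exists>h'\<in>active_infosets G i. info_less h h' \<and> passes h' z)}"

text \<open>\<open>opp_continuing G i h a' a\<close> is $S_{a',a}(h)$.\<close>

definition opp_continuing ::
  "('i, 'th, 'a, 'y) game \<Rightarrow> 'i \<Rightarrow> ('i, 'th, 'a) hist set \<Rightarrow> 'a \<Rightarrow> 'a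
     \<Rightarrow> ('i, 'th, 'a) opponents set" where
  "opp_continuing G i h a' a =
     opp_allowing G i h - (opp_ending G i h a' \<union> opp_ending G i h a)"

definition local_partition ::
  "('i, 'th, 'a, 'y) game \<Rightarrow> 'i \<Rightarrow> ('i, 'th, 'a) hist set \<Rightarrow> 'a \<Rightarrow> 'a
     \<Rightarrow> ('i, 'th, 'a) opponents set set" where
  "local_partition G i h a' a =
     {opp_ending G i h a \<inter> opp_ending G i h a',
      opp_ending G i h a' - opp_ending G i h a,
      opp_ending G i h a - opp_ending G i h a',
      opp_continuing G i h a' a}"

definition first_active_after ::
  "('i, 'th, 'a, 'y) game \<Rightarrow> 'i \<Rightarrow> ('i, 'th, 'a) hist set \<Rightarrow> 'a \<Rightarrow> ('i, 'th, 'a) hist set set" where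
  "first_active_after G i h a =
     {h' \<in> active_infosets G i.
        (\<exists>x\<in>h. \<exists>y\<in>h'. hist_less x y \<and> (snd y ! length (snd x)) i = a) \<and>
        \<not> (\<exists>h''\<in>active_infosets G i. info_less h h'' \<and> info_less h'' h')}"

definition mimics ::
  "('i, 'th, 'a, 'y) game \<Rightarrow> 'i \<Rightarrow> ('i, 'th, 'a) hist set \<Rightarrow> ('i, 'th, 'a) opponents set
     \<Rightarrow> ('i, 'th, 'a) strategy \<Rightarrow> ('i, 'th, 'a) strategy \<Rightarrow> bool" where
  "mimics G i h R s' s \<longleftrightarrow>
     (\<forall>r\<in>R. \<forall>h1\<in>first_active_after G i h (the (s' h)).
        \<forall>h2\<in>infosets G i. \<forall>h3\<in>infosets G i.
          info_le h1 h2 \<and> passes h2 (zeta G i s' r) \<and> passes h3 (zeta G i s r) \<and>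
          info_stage h2 = info_stage h3 \<longrightarrow> s' h2 = s h3)"

definition locally_dominates ::
  "('i, 'th, 'a, 'y) game \<Rightarrow> 'i \<Rightarrow> ('i, 'th, 'a) hist set \<Rightarrow> 'a \<Rightarrow> 'a \<Rightarrow> bool" where
  "locally_dominates G i h a' a \<longleftrightarrow>
     (\<forall>R\<in>local_partition G i h a' a. R \<noteq> {} \<longrightarrow>
        (\<forall>s\<in>strategies_choosing G i h a. \<exists>s'\<in>strategies_choosing G i h a'.
           mimics G i h R s' s \<and>
           (R \<noteq> opp_continuing G i h a' a \<longrightarrow>
              Min ((\<lambda>r. payoff G i (zeta G i s' r)) ` R)
                \<ge> Max ((\<lambda>r. payoff G i (zeta G i s r)) ` R)) \<and>
           (R = opp_continuing G i h a' a \<longrightarrow>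
              (\<forall>r\<in>R. outcome G i (zeta G i s' r) = outcome G i (zeta G i s r)))))"

definition locally_dominant ::
  "('i, 'th, 'a, 'y) game \<Rightarrow> 'i \<Rightarrow> ('i, 'th, 'a) hist set \<Rightarrow> 'a \<Rightarrow> bool" where
  "locally_dominant G i h a' \<longleftrightarrow>
     a' \<in> acts G i h \<and> (\<forall>a\<in>acts G i h - {a'}. locally_dominates G i h a' a)"

text \<open>The strategy \<open>s\<close> records which locally dominant action the player picks at each information
  set, in case there is more than one.\<close>

definition locally_strategy_proof :: "('i, 'th, 'a, 'y) game \<Rightarrow> bool" where
  "locally_strategy_proof G \<longleftrightarrow>
     (\<forall>i. \<exists>s\<in>strategies G i. \<forall>h\<in>active_infosets G i.
        s \<in> strategies_allowing G i h \<longrightarrow> locally_dominant G i h (the (s h)))"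

section \<open>The ascending-price auction\<close>

datatype move = Bid | Leave | Wait

datatype result = Wins nat | Lottery nat real | Nothing

definition bidders :: "('i \<Rightarrow> move) \<Rightarrow> 'i set" where
  "bidders a = {i. a i = Bid}"

text \<open>The object is assigned at the first stage at which at most one player bids.\<close>

definition assigned :: "('i \<Rightarrow> move) list \<Rightarrow> bool" where
  "assigned as \<longleftrightarrow> (\<exists>a\<in>set as. card (bidders a) \<le> 1)"

definition has_left :: "('i \<Rightarrow> move) list \<Rightarrow> 'i \<Rightarrow> bool" where
  "has_left as i \<longleftrightarrow> (\<exists>a\<in>set as. a i = Leave)"

definition auction_avail :: "bool \<Rightarrow> 'i \<Rightarrow> ('i, 'i \<Rightarrow> int, move) hist \<Rightarrow> move set" where
  "auction_avail waiting i x =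
     (if assigned (snd x) \<or> has_left (snd x) i then {Leave}
      else if waiting then {Bid, Leave, Wait} else {Bid, Leave})"

text \<open>A bidder knows her valuation and her own past actions and observes, at every stage, only
  whether the object has already been assigned.\<close>

definition auction_indist ::
  "'i \<Rightarrow> ('i, 'i \<Rightarrow> int, move) hist \<Rightarrow> ('i, 'i \<Rightarrow> int, move) hist \<Rightarrow> bool" where
  "auction_indist i x y \<longleftrightarrow>
     fst x i = fst y i \<and> map (\<lambda>a. a i) (snd x) = map (\<lambda>a. a i) (snd y) \<and>
     (\<forall>k. assigned (take k (snd x)) \<longleftrightarrow> assigned (take k (snd y)))"

text \<open>\<open>lot p R i\<close> is the probability that \<open>i\<close> receives the object when it is assigned at random at
  price \<open>p\<close> among the bidders in \<open>R\<close>.  List position \<open>t\<close> is stage, and price, \<open>Suc t\<close>.  If several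
  players still bid at the last stage, the object is not assigned.\<close>

definition auction_outcome ::
  "(nat \<Rightarrow> 'i set \<Rightarrow> 'i \<Rightarrow> real) \<Rightarrow> 'i \<Rightarrow> ('i, 'i \<Rightarrow> int, move) hist \<Rightarrow> result" where
  "auction_outcome lot i z =
     (let as = snd z in
      if \<not> assigned as then Nothing
      else
        let t = (LEAST t. t < length as \<and> card (bidders (as ! t)) \<le> 1);
            R = {j. \<not> has_left (take t as) j}
        in if bidders (as ! t) = {}
           then (if i \<in> R then Lottery (Suc t) (lot (Suc t) R i) else Nothing)
           else (if i \<in> bidders (as ! t) then Wins (Suc t) else Nothing))"

text \<open>\<open>lpay i v p q\<close> is what a lottery giving the object at price \<open>p\<close> with probability \<open>q\<close> is worth
  to bidder \<open>i\<close> with valuation \<open>v\<close>.\<close>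

definition auction_payoff ::
  "(nat \<Rightarrow> 'i set \<Rightarrow> 'i \<Rightarrow> real) \<Rightarrow> ('i \<Rightarrow> int \<Rightarrow> nat \<Rightarrow> real \<Rightarrow> real)
     \<Rightarrow> 'i \<Rightarrow> ('i, 'i \<Rightarrow> int, move) hist \<Rightarrow> real" where
  "auction_payoff lot lpay i z =
     (case auction_outcome lot i z of
        Wins p \<Rightarrow> of_int (fst z i) - of_nat p
      | Lottery p q \<Rightarrow> lpay i (fst z i) p q
      | Nothing \<Rightarrow> 0)"

definition auction ::
  "bool \<Rightarrow> ('i \<Rightarrow> int) set \<Rightarrow> nat \<Rightarrow> (nat \<Rightarrow> 'i set \<Rightarrow> 'i \<Rightarrow> real)
     \<Rightarrow> ('i \<Rightarrow> int \<Rightarrow> nat \<Rightarrow> real \<Rightarrow> real) \<Rightarrow> ('i, 'i \<Rightarrow> int, move, result) game" where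
  "auction waiting \<Theta> T lot lpay =
     \<lparr> nature = \<Theta>, horizon = T, avail = auction_avail waiting, indist = auction_indist,
       outcome = auction_outcome lot, payoff = auction_payoff lot lpay \<rparr>"

lemma multistage_game_auction:
  fixes \<Theta> :: "('i::finite \<Rightarrow> int) set"
  assumes "finite \<Theta>" "\<Theta> \<noteq> {}" "1 \<le> T"
  shows "multistage_game (auction waiting \<Theta> T lot lpay)"
proof -
  let ?G = "auction waiting \<Theta> T lot lpay"
  have len: "length (snd x) = length (snd y)" if "auction_indist i x y" for i and x y :: "('i, 'i \<Rightarrow> int, move) hist"
    using that unfolding auction_indist_def by (metis length_map)
  have own: "(snd x ! k) i = (snd y ! k) i"
    if "auction_indist i x y" "k < length (snd x)" for i k and x y :: "('i, 'i \<Rightarrow> int, move) hist"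
    using that len[OF that(1)] unfolding auction_indist_def by (metis nth_map)
  have tr: "auction_indist i (trunc k x) (trunc k y)"
    if "auction_indist i x y" for i k and x y :: "('i, 'i \<Rightarrow> int, move) hist"
    using that unfolding auction_indist_def trunc_def by (simp add: take_map[symmetric])
  have left_iff: "has_left as i \<longleftrightarrow> Leave \<in> set (map (\<lambda>a. a i) as)" for as and i :: 'i
    unfolding has_left_def by (auto simp: image_iff eq_commute)
  have av: "auction_avail waiting i x = auction_avail waiting i y"
    if "auction_indist i x y" for i and x y :: "('i, 'i \<Rightarrow> int, move) hist"
  proof -
    have "assigned (snd x) \<longleftrightarrow> assigned (snd y)"
      using that len[OF that] unfolding auction_indist_def by (metis order_refl take_all)
    moreover have "has_left (snd x) i \<longleftrightarrow> has_left (snd y) i"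
      using that unfolding left_iff auction_indist_def by simp
    ultimately show ?thesis by (simp add: auction_avail_def)
  qed
  have eqv: "equiv X {(x, y). x \<in> X \<and> y \<in> X \<and> auction_indist i x y}" for X i
    unfolding equiv_def refl_on_def sym_def trans_def auction_indist_def by auto
  have avail_ok: "finite (auction_avail waiting i x) \<and> auction_avail waiting i x \<noteq> {}"
    for i and x :: "('i, 'i \<Rightarrow> int, move) hist"
    by (simp add: auction_avail_def)
  have G: "nature ?G = \<Theta>" "horizon ?G = T" "avail ?G = auction_avail waiting"
    "indist ?G = auction_indist"
    by (simp_all add: auction_def)
  have st: "stage x = stage y" if "auction_indist i x y"
    for i and x y :: "('i, 'i \<Rightarrow> int, move) hist"
    using len[OF that] by (simp add: stage_def)
  show ?thesis
    unfolding multistage_game_def G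
    using assms by (intro conjI allI ballI impI) (simp_all add: avail_ok eqv st av tr own)
qed

end

theory Submission
  imports Defs
begin

text \<open>Perfect recall makes the play up to an information set \<open>h\<close> depend on the opponents only, so
  every deviation from \<open>h\<close> onwards meets the same rivals at \<open>h\<close>.  Below the valuation, bidding
  against no rival wins at a profit that no lottery at that price exceeds.  Against rivals, leaving,
  and waiting when there is just one, yields nothing, whereas bidding and then leaving yields at
  least \<open>0\<close>, the next price being at most the valuation.  Bidding and waiting both keep the bidder in
  only if at least two rivals bid; opponents then cannot tell the two apart, so copying the
  continuation gives the same outcome.  From the valuation onwards the bidder cannot gain at the
  current or any later price, while leaving costs at most what winning now would.\<close>

section \<open>Plays in multistage games\<close>

text \<open>The mimicry clause shapes the proof: a continuation may be chosen freely only where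
  copying costs nothing. Where the rejected action ends the bidder's participation, the strategy to
  be copied can only play \<open>Leave\<close> afterwards, so bidding once and leaving from then on
  qualifies in every such cell of the partition. Real copying is confined to \<open>Wait\<close>;
  there a bidder who has bid cannot see whether one or several rivals did so, and the copied
  strategy has to be looked up through a chosen representative. Comparing a minimum with a maximum
  over a cell amounts to finding a number between the payoffs: the surplus of winning at the current
  price when there is no rival, and \<open>0\<close> otherwise. A truthful bidder is active at a
  price above her valuation at the first stage only. With waiting, leaving need not dominate there:
  opponents with no bid and with one bid share a cell, leaving may lose in the lottery against the
  former, and waiting yields \<open>0\<close> against the latter. This is the origin of the bound
  \<open>1 \<le> \<theta> i\<close> for that variant.\<close>

lemma hists_at_iff:
  "x \<in> hists_at G n \<longleftrightarrow> fst x \<in> nature G \<and> length (snd x) = n \<and>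
     (\<forall>k<n. \<forall>i. (snd x ! k) i \<in> avail G i (trunc k x))"
proof (induction n arbitrary: x)
  case 0
  then show ?case by (cases x) auto
next
  case (Suc n)
  obtain \<theta> bs where x: "x = (\<theta>, bs)" by (cases x)
  show ?case
  proof (cases bs rule: rev_cases)
    case Nil
    then show ?thesis using x by auto
  next
    case (snoc as a)
    have "x \<in> hists_at G (Suc n) \<longleftrightarrow>
        (\<theta>, as) \<in> hists_at G n \<and> (\<forall>i. a i \<in> avail G i (\<theta>, as))"
      using x snoc by auto
    also have "\<dots> \<longleftrightarrow> fst x \<in> nature G \<and> length (snd x) = Suc n \<and>
        (\<forall>k<Suc n. \<forall>i. (snd x ! k) i \<in> avail G i (trunc k x))"
      unfolding Suc.IH x snoc
      by (auto simp: trunc_def less_Suc_eq nth_append)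
    finally show ?thesis .
  qed
qed

lemma hists_at_SucI:
  "(\<theta>, as) \<in> hists_at G n \<Longrightarrow> (\<And>i. a i \<in> avail G i (\<theta>, as)) \<Longrightarrow> (\<theta>, as @ [a]) \<in> hists_at G (Suc n)"
  by auto

lemma hists_iff: "x \<in> hists G \<longleftrightarrow> length (snd x) < horizon G \<and> x \<in> hists_at G (length (snd x))"
  unfolding hists_def by (auto simp: hists_at_iff)

lemma length_trunc [simp]: "length (snd (trunc k x)) = min (length (snd x)) k"
  by (simp add: trunc_def)

lemma trunc_trunc [simp]: "trunc j (trunc k x) = trunc (min j k) x"
  by (simp add: trunc_def)

lemma trunc_length [simp]: "trunc (length (snd x)) x = x"
  by (simp add: trunc_def)

lemma nth_trunc [simp]: "j < k \<Longrightarrow> snd (trunc k x) ! j = snd x ! j"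
  by (simp add: trunc_def)

lemma fst_trunc [simp]: "fst (trunc k x) = fst x"
  by (simp add: trunc_def)

lemma trunc_hists_at: "x \<in> hists_at G n \<Longrightarrow> k \<le> n \<Longrightarrow> trunc k x \<in> hists_at G k"
  unfolding hists_at_iff by simp

lemma trunc_hists: "x \<in> hists_at G n \<Longrightarrow> k \<le> n \<Longrightarrow> k < horizon G \<Longrightarrow> trunc k x \<in> hists G"
  using trunc_hists_at[of x G n k] by (simp add: hists_iff hists_at_iff)

text \<open>Predecessors of a play become plays cut short, so the order on histories turns into the
  order on stage numbers.\<close>

lemma hist_less_iff: "hist_less x z \<longleftrightarrow> (\<exists>k < length (snd z). x = trunc k z)"
proof
  assume h: "hist_less x z"
  then obtain ys where "snd z = snd x @ ys" "ys \<noteq> []" "fst x = fst z"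
    unfolding hist_less_def by (auto simp: strict_prefix_def prefix_def)
  then have "x = trunc (length (snd x)) z" "length (snd x) < length (snd z)"
    by (simp_all add: trunc_def prod_eq_iff)
  then show "\<exists>k < length (snd z). x = trunc k z" by blast
next
  assume "\<exists>k < length (snd z). x = trunc k z"
  then show "hist_less x z"
    unfolding hist_less_def trunc_def
    by (auto simp: strict_prefix_def take_is_prefix)
qed

lemma fst_path [simp]: "fst (path G \<theta> \<sigma> k) = \<theta>"
  by (cases k) auto

lemma length_path [simp]: "length (snd (path G \<theta> \<sigma> k)) = k"
  by (induction k) auto

lemma trunc_path [simp]: "j \<le> k \<Longrightarrow> trunc j (path G \<theta> \<sigma> k) = path G \<theta> \<sigma> j"
proof (induction k)
  case (Suc k)
  show ?case
  proof (cases "j = Suc k")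
    case True
    then show ?thesis by (metis length_path trunc_length)
  next
    case False
    then have "j \<le> k" using Suc.prems by simp
    moreover from this have "trunc j (path G \<theta> \<sigma> (Suc k)) = trunc j (path G \<theta> \<sigma> k)"
      by (simp add: trunc_def)
    ultimately show ?thesis using Suc.IH by simp
  qed
qed (simp add: trunc_def)

lemma nth_path:
  "j < k \<Longrightarrow> snd (path G \<theta> \<sigma> k) ! j = (\<lambda>l. the (\<sigma> l (infoset G l (path G \<theta> \<sigma> j))))"
proof -
  assume "j < k"
  then have "snd (path G \<theta> \<sigma> k) ! j = snd (trunc (Suc j) (path G \<theta> \<sigma> k)) ! j"
    by (simp only: nth_trunc lessI)
  also have "trunc (Suc j) (path G \<theta> \<sigma> k) = path G \<theta> \<sigma> (Suc j)"
    using \<open>j < k\<close> by (intro trunc_path) simp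
  finally show ?thesis
    using nth_append_length[of "snd (path G \<theta> \<sigma> j)"
        "\<lambda>l. the (\<sigma> l (infoset G l (path G \<theta> \<sigma> j)))" "[]"]
    by (simp only: length_path path.simps(2) snd_conv)
qed

section \<open>One player's plays against fixed opponents\<close>

definition play ::
  "('i, 'th, 'a, 'y) game \<Rightarrow> 'i \<Rightarrow> ('i, 'th, 'a) strategy \<Rightarrow> ('i, 'th, 'a) opponents \<Rightarrow> nat
     \<Rightarrow> ('i, 'th, 'a) hist" where
  "play G i s r = path G (fst r) ((snd r)(i := s))"

lemma zeta_play: "zeta G i s r = play G i s r (horizon G)"
  by (simp only: zeta_def play_def)

lemma fst_play [simp]: "fst (play G i s r k) = fst r"
  by (simp only: play_def fst_path)

lemma length_play [simp]: "length (snd (play G i s r k)) = k"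
  by (simp only: play_def length_path)

lemma trunc_play [simp]: "j \<le> k \<Longrightarrow> trunc j (play G i s r k) = play G i s r j"
  by (simp only: play_def trunc_path)

lemma nth_play_own: "j < k \<Longrightarrow> (snd (play G i s r k) ! j) i = the (s (infoset G i (play G i s r j)))"
  by (simp only: play_def nth_path fun_upd_same)

lemma nth_play_other:
  "j < k \<Longrightarrow> l \<noteq> i \<Longrightarrow>
     (snd (play G i s r k) ! j) l = the (snd r l (infoset G l (play G i s r j)))"
  by (simp only: play_def nth_path fun_upd_apply if_False)

lemma play_0: "play G i s r 0 = (fst r, [])"
  by (simp only: play_def path.simps)

lemma play_Suc:
  "play G i s r (Suc k) = (fst r, snd (play G i s r k) @ [\<lambda>l. the
     ((if l = i then s else snd r l) (infoset G l (play G i s r k)))])"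
  unfolding play_def path.simps by (simp only: fun_upd_apply)

text \<open>The opponents react to the history alone, so two plays can separate only where the
  strategies of \<open>i\<close> differ; it suffices to compare these along one of the
  plays.\<close>

lemma play_agree:
  assumes "\<And>j. j < k \<Longrightarrow> s' (infoset G i (play G i s r j)) = s (infoset G i (play G i s r j))"
  shows "j \<le> k \<Longrightarrow> play G i s' r j = play G i s r j"
proof (induction j)
  case (Suc j)
  have eq: "play G i s' r j = play G i s r j" by (rule Suc.IH) (use Suc.prems in simp)
  have "the ((if l = i then s' else snd r l) (infoset G l (play G i s r j))) =
      the ((if l = i then s else snd r l) (infoset G l (play G i s r j)))" for l
    using assms[of j] Suc.prems eq by auto
  then show ?case by (simp only: play_Suc eq)
qed (simp add: play_0)

text \<open>The domain is cut out by the total plan \<open>p\<close> and not by the resulting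
  partial map. This avoids the circularity in \<open>strategies\<close>, where the domain of a
  strategy refers to the strategy itself.\<close>

definition reduced_strategy ::
  "('i, 'th, 'a, 'y) game \<Rightarrow> 'i \<Rightarrow> (('i, 'th, 'a) hist set \<Rightarrow> 'a) \<Rightarrow> ('i, 'th, 'a) strategy" where
  "reduced_strategy G i p h =
     (if h \<in> infosets G i \<and>
         (\<exists>x\<in>h. \<forall>k < length (snd x). p (infoset G i (trunc k x)) = (snd x ! k) i)
      then Some (p h) else None)"

lemma strategies_defined:
  assumes "s \<in> strategies G i" "h \<in> infosets G i" "x \<in> h" "consistent G i s x"
  shows "\<exists>a\<in>acts G i h. s h = Some a"
proof -
  have "h \<in> dom s" "\<forall>h\<in>dom s. the (s h) \<in> acts G i h"
    using assms unfolding strategies_def by blast+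
  then show ?thesis by (metis domD option.sel)
qed

text \<open>A common threshold \<open>c\<close> replaces the comparison of all pairs of opponents in
  a cell.\<close>

lemma Max_image_le_Min_image:
  fixes f g :: "'a \<Rightarrow> 'b::linorder"
  assumes "finite (f ` R)" "finite (g ` R)" "R \<noteq> {}"
    and "\<And>r. r \<in> R \<Longrightarrow> f r \<le> c" "\<And>r. r \<in> R \<Longrightarrow> c \<le> g r"
  shows "Max (f ` R) \<le> Min (g ` R)"
proof -
  have "Max (f ` R) \<le> c" "c \<le> Min (g ` R)"
    using assms by auto
  then show ?thesis by simp
qed

section \<open>Information sets under perfect recall\<close>

locale multistage =
  fixes G :: "('i::finite, 'th, 'a, 'y) game"
  assumes wf: "multistage_game G"
begin

lemma avail_finite: "x \<in> hists G \<Longrightarrow> finite (avail G i x)"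
  using wf unfolding multistage_game_def by blast

lemma indist_equiv: "equiv (hists G) {(x, y). x \<in> hists G \<and> y \<in> hists G \<and> indist G i x y}"
  using wf unfolding multistage_game_def by blast

lemma indist_refl: "x \<in> hists G \<Longrightarrow> indist G i x x"
  using indist_equiv[of i] unfolding equiv_def refl_on_def by blast

lemma indist_sym: "x \<in> hists G \<Longrightarrow> y \<in> hists G \<Longrightarrow> indist G i x y \<Longrightarrow> indist G i y x"
  using indist_equiv[of i] unfolding equiv_def sym_def by blast

lemma indist_trans:
  "x \<in> hists G \<Longrightarrow> y \<in> hists G \<Longrightarrow> z \<in> hists G \<Longrightarrow> indist G i x y \<Longrightarrow> indist G i y z
     \<Longrightarrow> indist G i x z"
  using indist_equiv[of i] unfolding equiv_def trans_def by blast

lemma indistD: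
  assumes "x \<in> hists G" "y \<in> hists G" "indist G i x y"
  shows "length (snd y) = length (snd x)" "avail G i y = avail G i x"
    and "k < length (snd x) \<Longrightarrow> indist G i (trunc k x) (trunc k y)"
    and "k < length (snd x) \<Longrightarrow> (snd y ! k) i = (snd x ! k) i"
proof -
  have *: "stage x = stage y \<and> avail G i x = avail G i y \<and>
      (\<forall>k < length (snd x).
         indist G i (trunc k x) (trunc k y) \<and> (snd x ! k) i = (snd y ! k) i)"
    using wf assms unfolding multistage_game_def by blast
  show "length (snd y) = length (snd x)" "avail G i y = avail G i x"
    using * by (simp_all add: stage_def)
  show "k < length (snd x) \<Longrightarrow> indist G i (trunc k x) (trunc k y)"
    "k < length (snd x) \<Longrightarrow> (snd y ! k) i = (snd x ! k) i"
    using * by simp_all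
qed

lemma mem_infosetD: "y \<in> infoset G i x \<Longrightarrow> y \<in> hists G \<and> indist G i x y"
  unfolding infoset_def by blast

lemma mem_infoset_self: "x \<in> hists G \<Longrightarrow> x \<in> infoset G i x"
  unfolding infoset_def using indist_refl by blast

lemma infoset_eq:
  "x \<in> hists G \<Longrightarrow> y \<in> infoset G i x \<Longrightarrow> infoset G i y = infoset G i x"
  unfolding infoset_def using indist_sym indist_trans by blast

lemma infosets_eq:
  assumes "h \<in> infosets G i" "x \<in> h"
  shows "h = infoset G i x" "x \<in> hists G"
proof -
  obtain y where "y \<in> hists G" "h = infoset G i y"
    using assms unfolding infosets_def by blast
  then show "h = infoset G i x" "x \<in> hists G"
    using assms infoset_eq mem_infosetD by blast+
qed

lemma infoset_in_infosets: "x \<in> hists G \<Longrightarrow> infoset G i x \<in> infosets G i"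
  unfolding infosets_def by blast

lemma infosetsE:
  assumes "h \<in> infosets G i"
  obtains x where "x \<in> hists G" "x \<in> h" "h = infoset G i x"
  using assms mem_infoset_self unfolding infosets_def by blast

lemma infoset_length:
  "x \<in> hists G \<Longrightarrow> y \<in> infoset G i x \<Longrightarrow> length (snd y) = length (snd x)"
  using mem_infosetD indistD(1) by blast

lemma infoset_trunc:
  assumes "x \<in> hists G" "y \<in> infoset G i x" "k \<le> length (snd x)"
  shows "infoset G i (trunc k y) = infoset G i (trunc k x)"
proof (cases "k = length (snd x)")
  \<comment> \<open>Perfect recall speaks of proper truncations only; at full length the equality of
    information sets has to come from indistinguishability itself.\<close>
  case True
  then show ?thesis using assms infoset_length infoset_eq trunc_length by metis
next
  case False
  then have "trunc k y \<in> infoset G i (trunc k x)" "trunc k x \<in> hists G"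
    using assms mem_infosetD[OF assms(2)] infoset_length[OF assms(1,2)]
      indistD(3)[of x y i k] trunc_hists[of y G "length (snd y)" k]
      trunc_hists[of x G "length (snd x)" k]
    by (auto simp: infoset_def hists_iff)
  then show ?thesis using infoset_eq by blast
qed

lemma acts_infoset: "x \<in> hists G \<Longrightarrow> acts G i (infoset G i x) = avail G i x"
  unfolding acts_def using mem_infosetD indistD(2) mem_infoset_self[of x i] by blast

lemma info_stage_infoset: "x \<in> hists G \<Longrightarrow> info_stage (infoset G i x) = stage x"
proof -
  assume x: "x \<in> hists G"
  then have "stage ` infoset G i x = {stage x}"
    using mem_infoset_self[OF x, of i] infoset_length[OF x] unfolding stage_def by blast
  then show ?thesis by (simp add: info_stage_def)
qed

lemma finite_hists_at: "n \<le> horizon G \<Longrightarrow> finite (hists_at G n)"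
proof (induction n)
  case 0
  have "hists_at G 0 = (\<lambda>\<theta>. (\<theta>, [])) ` nature G" by auto
  then show ?case using wf unfolding multistage_game_def by simp
next
  case (Suc n)
  have sub: "hists_at G (Suc n) \<subseteq>
      (\<Union>x\<in>hists_at G n. (\<lambda>a. (fst x, snd x @ [a])) ` (PiE UNIV (\<lambda>i. avail G i x)))"
  proof
    fix x assume "x \<in> hists_at G (Suc n)"
    then obtain \<theta> as a where "x = (\<theta>, as @ [a])" "(\<theta>, as) \<in> hists_at G n"
      "\<forall>i. a i \<in> avail G i (\<theta>, as)"
      unfolding hists_at.simps by blast
    then show "x \<in> (\<Union>x\<in>hists_at G n. (\<lambda>a. (fst x, snd x @ [a])) ` (PiE UNIV (\<lambda>i. avail G i x)))"
      by (intro UN_I[of "(\<theta>, as)"]) (simp_all add: PiE_UNIV_domain)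
  qed
  have fin: "finite (avail G i x)" if "x \<in> hists_at G n" for i x
  proof -
    have "x \<in> hists G" using that Suc.prems unfolding hists_def by auto
    then show ?thesis using avail_finite by blast
  qed
  show ?case
    by (rule finite_subset[OF sub], rule finite_UN_I)
       (use Suc fin in \<open>simp_all add: finite_PiE\<close>)
qed

text \<open>The three claims need a joint induction: a reduced strategy is defined at the next
  information set only because the path is consistent with it so far, and the path is a history only
  because the actions so obtained are available.\<close>

lemma path_hist:
  assumes "\<theta> \<in> nature G" "\<And>j. \<sigma> j \<in> strategies G j" "k \<le> horizon G"
  shows "path G \<theta> \<sigma> k \<in> hists_at G k \<and> (\<forall>j. consistent G j (\<sigma> j) (path G \<theta> \<sigma> k)) \<and>
    (\<forall>j n. n < k \<longrightarrow> (\<exists>a\<in>avail G j (path G \<theta> \<sigma> n).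
       \<sigma> j (infoset G j (path G \<theta> \<sigma> n)) = Some a))"
  using assms(3)
proof (induction k)
  case 0
  then show ?case using assms(1) by (simp add: consistent_def)
next
  case (Suc k)
  let ?x = "path G \<theta> \<sigma> k"
  have x: "?x \<in> hists G" using Suc by (simp add: hists_iff)
  have a: "\<exists>a\<in>avail G j ?x. \<sigma> j (infoset G j ?x) = Some a" for j
    using strategies_defined[OF assms(2)[of j] infoset_in_infosets[OF x] mem_infoset_self[OF x]]
      Suc.IH Suc.prems acts_infoset[OF x, of j] by simp
  have next_eq: "path G \<theta> \<sigma> (Suc k) = (\<theta>, snd ?x @ [\<lambda>j. the (\<sigma> j (infoset G j ?x))])" by simp
  have "path G \<theta> \<sigma> (Suc k) \<in> hists_at G (Suc k)"
  proof -
    have eq: "(\<theta>, snd ?x) = ?x" by (metis fst_path prod.collapse)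
    have "the (\<sigma> j (infoset G j ?x)) \<in> avail G j ?x" for j
      using a[of j] by (metis option.sel)
    then show ?thesis
      unfolding next_eq
      using Suc hists_at_SucI[of \<theta> "snd ?x" G k "\<lambda>j. the (\<sigma> j (infoset G j ?x))"]
      by (simp only: eq Suc_leD)
  qed
  moreover have "consistent G j (\<sigma> j) (path G \<theta> \<sigma> (Suc k))" for j
    unfolding consistent_def
  proof (intro allI impI)
    fix n assume "n < length (snd (path G \<theta> \<sigma> (Suc k)))"
    then have n: "n < Suc k" by simp
    have "\<exists>a. \<sigma> j (infoset G j (path G \<theta> \<sigma> n)) = Some a"
    proof (cases "n = k")
      case False
      then show ?thesis using n Suc.IH Suc.prems by (simp add: less_Suc_eq) blast
    qed (use a[of j] in blast)
    then show "\<sigma> j (infoset G j (trunc n (path G \<theta> \<sigma> (Suc k)))) =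
        Some ((snd (path G \<theta> \<sigma> (Suc k)) ! n) j)"
      using n nth_path[OF n, of G \<theta> \<sigma>] trunc_path[of n "Suc k" G \<theta> \<sigma>]
      by (auto simp del: path.simps)
  qed
  moreover have "\<exists>a\<in>avail G j (path G \<theta> \<sigma> n). \<sigma> j (infoset G j (path G \<theta> \<sigma> n)) = Some a"
    if "n < Suc k" for j n
    using that Suc.IH Suc.prems a[of j] by (cases "n = k") (simp_all add: less_Suc_eq)
  ultimately show ?case by blast
qed

section \<open>Reaching an information set\<close>

lemma opp_strategiesD:
  assumes "s \<in> strategies G i" "r \<in> opp_strategies G i"
  shows "fst r \<in> nature G" "((snd r)(i := s)) j \<in> strategies G j"
proof -
  have r: "fst r \<in> nature G" "snd r \<in> PiE (- {i}) (strategies G)"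
    using assms(2) unfolding opp_strategies_def by (simp_all add: mem_Times_iff)
  show "fst r \<in> nature G" by (rule r)
  show "((snd r)(i := s)) j \<in> strategies G j"
    using assms(1) PiE_mem[OF r(2), of j] by (cases "j = i") simp_all
qed

lemma play_hists_at:
  assumes "s \<in> strategies G i" "r \<in> opp_strategies G i" "k \<le> horizon G"
  shows "play G i s r k \<in> hists_at G k"
  unfolding play_def
  by (rule path_hist[of "fst r" "(snd r)(i := s)" k, THEN conjunct1])
     (rule opp_strategiesD[OF assms(1,2)] assms(3))+

lemma play_hists:
  assumes "s \<in> strategies G i" "r \<in> opp_strategies G i" "k < horizon G"
  shows "play G i s r k \<in> hists G"
  using play_hists_at[OF assms(1,2), of k] assms(3) by (simp add: hists_iff)

lemma play_consistent:
  assumes "s \<in> strategies G i" "r \<in> opp_strategies G i" "k \<le> horizon G"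
  shows "consistent G i s (play G i s r k)"
proof -
  have "consistent G i (((snd r)(i := s)) i) (play G i s r k)"
    unfolding play_def
    by (rule path_hist[of "fst r" "(snd r)(i := s)" k, THEN conjunct2, THEN conjunct1, THEN spec])
       (rule opp_strategiesD[OF assms(1,2)] assms(3))+
  then show ?thesis by simp
qed

lemma play_action:
  assumes "s \<in> strategies G i" "r \<in> opp_strategies G i" "k < n" "n \<le> horizon G"
  shows "s (infoset G i (play G i s r k)) = Some ((snd (play G i s r n) ! k) i)"
  using play_consistent[OF assms(1,2,4)] assms(3) unfolding consistent_def by simp

lemma play_avail:
  assumes "s \<in> strategies G i" "r \<in> opp_strategies G i" "k < n" "n \<le> horizon G"
  shows "(snd (play G i s r n) ! k) j \<in> avail G j (play G i s r k)"
  using play_hists_at[OF assms(1,2,4)] assms(3) unfolding hists_at_iff by simp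

text \<open>All members of an information set have the same length, so a play can pass through it at
  that stage only.\<close>

lemma passes_zeta_iff:
  assumes "x \<in> hists G"
  shows "passes (infoset G i x) (zeta G j s r) \<longleftrightarrow>
    play G j s r (length (snd x)) \<in> infoset G i x"
proof -
  have T: "length (snd x) < horizon G" using assms by (simp add: hists_iff)
  have less: "hist_less y (zeta G j s r) \<longleftrightarrow> (\<exists>k < horizon G. y = play G j s r k)" for y
    unfolding zeta_play hist_less_iff by (metis length_play less_imp_le trunc_play)
  show ?thesis
    unfolding passes_def less using T infoset_length[OF assms] by (metis length_play)
qed

lemma passes_zetaE:
  assumes "h \<in> infosets G i" "passes h (zeta G j s r)"
  obtains k where "k < horizon G" "play G j s r k \<in> hists G" "h = infoset G i (play G j s r k)"
    "info_stage h = Suc k"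
proof -
  obtain x where x: "x \<in> hists G" "h = infoset G i x" using infosetsE[OF assms(1)] by blast
  let ?y = "play G j s r (length (snd x))"
  have "?y \<in> h" using assms(2) passes_zeta_iff x by blast
  then have "h = infoset G i ?y" "?y \<in> hists G" using infosets_eq[OF assms(1)] by blast+
  moreover from this have "info_stage h = Suc (length (snd x))"
    using info_stage_infoset by (simp add: stage_def)
  moreover have "length (snd x) < horizon G" using x by (simp add: hists_iff)
  ultimately show thesis using that by blast
qed

text \<open>Some play of \<open>s\<close> reaches the information set; perfect recall transfers the
  actions of \<open>i\<close> on that play to the representative \<open>x\<close>.\<close>

lemma allowing_consistent:
  assumes "x \<in> hists G" "s \<in> strategies_allowing G i (infoset G i x)" "k < length (snd x)"
  shows "s (infoset G i (trunc k x)) = Some ((snd x ! k) i)"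
proof -
  obtain r where r: "r \<in> opp_strategies G i" "s \<in> strategies G i"
    "play G i s r (length (snd x)) \<in> infoset G i x"
    using assms passes_zeta_iff unfolding strategies_allowing_def by blast
  let ?y = "play G i s r (length (snd x))"
  have "length (snd x) \<le> horizon G" using assms by (simp add: hists_iff)
  then have "s (infoset G i (trunc k ?y)) = Some ((snd ?y ! k) i)"
    using play_consistent[OF r(2,1)] assms(3) unfolding consistent_def by simp
  then show ?thesis
    using infoset_trunc[OF assms(1) r(3)] assms(3) mem_infosetD[OF r(3)]
      indistD(4)[OF assms(1)] by (metis less_imp_le)
qed

lemma play_infoset_trunc:
  assumes "x \<in> hists G" "play G i s r (length (snd x)) \<in> infoset G i x" "k \<le> length (snd x)"
  shows "infoset G i (play G i s r k) = infoset G i (trunc k x)"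
  using infoset_trunc[OF assms] assms(3) by simp

text \<open>Both strategies prescribe the own actions recorded in \<open>x\<close>, so they cannot
  separate before the information set.\<close>

lemma allowing_play_eq:
  assumes "x \<in> hists G" "r \<in> opp_strategies G i" "s \<in> strategies_allowing G i (infoset G i x)"
    and "s' \<in> strategies_allowing G i (infoset G i x)"
    and "play G i s r (length (snd x)) \<in> infoset G i x"
  shows "play G i s' r (length (snd x)) = play G i s r (length (snd x))"
proof (rule play_agree)
  fix j assume "j < length (snd x)"
  then show "s' (infoset G i (play G i s r j)) = s (infoset G i (play G i s r j))"
    using play_infoset_trunc[OF assms(1,5), of j] allowing_consistent[OF assms(1,3), of j]
      allowing_consistent[OF assms(1,4), of j] by simp
qed simp

lemma opp_allowingD:
  assumes "x \<in> hists G" "r \<in> opp_allowing G i (infoset G i x)"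
  shows "r \<in> opp_strategies G i"
    and "s \<in> strategies_allowing G i (infoset G i x) \<Longrightarrow>
      play G i s r (length (snd x)) \<in> infoset G i x"
    and "s \<in> strategies_allowing G i (infoset G i x) \<Longrightarrow>
      s' \<in> strategies_allowing G i (infoset G i x) \<Longrightarrow>
      play G i s' r (length (snd x)) = play G i s r (length (snd x))"
proof -
  show r: "r \<in> opp_strategies G i" using assms unfolding opp_allowing_def by blast
  obtain t where t: "t \<in> strategies G i" "passes (infoset G i x) (zeta G i t r)"
    using assms unfolding opp_allowing_def by blast
  then have t': "t \<in> strategies_allowing G i (infoset G i x)"
    using r unfolding strategies_allowing_def by blast
  have tp: "play G i t r (length (snd x)) \<in> infoset G i x"
    using t passes_zeta_iff[OF assms(1)] by blast
  show "play G i s r (length (snd x)) \<in> infoset G i x"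
    if "s \<in> strategies_allowing G i (infoset G i x)" for s
    using allowing_play_eq[OF assms(1) r t' that tp] tp by simp
  then show "s \<in> strategies_allowing G i (infoset G i x) \<Longrightarrow>
      s' \<in> strategies_allowing G i (infoset G i x) \<Longrightarrow>
      play G i s' r (length (snd x)) = play G i s r (length (snd x))"
    using allowing_play_eq[OF assms(1) r] by blast
qed

text \<open>The opponents that lead \<open>s\<close> to the information set lead \<open>s'\<close>
  there too, since the two agree on the way.\<close>

lemma strategies_allowing_deviation:
  assumes "x \<in> hists G" "s \<in> strategies_allowing G i (infoset G i x)" "s' \<in> strategies G i"
    and "\<And>k. k < length (snd x) \<Longrightarrow>
      s' (infoset G i (trunc k x)) = s (infoset G i (trunc k x))"
  shows "s' \<in> strategies_allowing G i (infoset G i x)"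
proof -
  obtain r where r: "r \<in> opp_strategies G i" "play G i s r (length (snd x)) \<in> infoset G i x"
    using assms(1,2) passes_zeta_iff unfolding strategies_allowing_def by blast
  have "play G i s' r (length (snd x)) = play G i s r (length (snd x))"
    by (rule play_agree[where k = "length (snd x)"])
       (simp_all add: play_infoset_trunc[OF assms(1) r(2)] assms(4))
  then show ?thesis
    using r assms(1,3) passes_zeta_iff unfolding strategies_allowing_def by fastforce
qed

section \<open>Reduced strategies from total plans\<close>

lemma reduced_strategy_consistent:
  assumes "x \<in> hists G"
  shows "consistent G i (reduced_strategy G i p) x \<longleftrightarrow>
    (\<forall>k < length (snd x). p (infoset G i (trunc k x)) = (snd x ! k) i)"
proof
  assume "consistent G i (reduced_strategy G i p) x"
  then show "\<forall>k < length (snd x). p (infoset G i (trunc k x)) = (snd x ! k) i"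
    unfolding consistent_def reduced_strategy_def by (metis option.inject option.simps(3))
next
  assume p: "\<forall>k < length (snd x). p (infoset G i (trunc k x)) = (snd x ! k) i"
  show "consistent G i (reduced_strategy G i p) x"
    unfolding consistent_def
  proof (intro allI impI)
    fix k assume k: "k < length (snd x)"
    have t: "trunc k x \<in> hists G"
      using assms k trunc_hists[of x G "length (snd x)" k] by (simp add: hists_iff)
    have "\<forall>n < length (snd (trunc k x)).
        p (infoset G i (trunc n (trunc k x))) = (snd (trunc k x) ! n) i"
      using p k by simp
    then have "\<exists>y\<in>infoset G i (trunc k x). \<forall>n < length (snd y).
        p (infoset G i (trunc n y)) = (snd y ! n) i"
      using mem_infoset_self[OF t, of i] by (rule bexI)
    then show "reduced_strategy G i p (infoset G i (trunc k x)) = Some ((snd x ! k) i)"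
      using infoset_in_infosets[OF t, of i] p k unfolding reduced_strategy_def by simp
  qed
qed

text \<open>Consistency with the plan and consistency with the partial map coincide, hence the
  domain cut out by \<open>p\<close> is the self-referential one that \<open>strategies\<close>
  demands.\<close>

lemma reduced_strategy_strategies:
  assumes "\<And>h. h \<in> infosets G i \<Longrightarrow> p h \<in> acts G i h"
  shows "reduced_strategy G i p \<in> strategies G i"
proof -
  have "dom (reduced_strategy G i p) =
      {h \<in> infosets G i. \<exists>x\<in>h. \<forall>k < length (snd x). p (infoset G i (trunc k x)) = (snd x ! k) i}"
    unfolding dom_def reduced_strategy_def by auto
  also have "\<dots> = {h \<in> infosets G i. \<exists>x\<in>h. consistent G i (reduced_strategy G i p) x}"
    using reduced_strategy_consistent infosets_eq(2) by blast
  finally have "dom (reduced_strategy G i p) = \<dots>" .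
  moreover have "the (reduced_strategy G i p h) \<in> acts G i h"
    if "h \<in> dom (reduced_strategy G i p)" for h
    using that assms[of h] unfolding reduced_strategy_def dom_def by (auto split: if_splits)
  ultimately show ?thesis unfolding strategies_def by blast
qed

lemma reduced_strategy_eq:
  "reduced_strategy G i p h \<noteq> None \<Longrightarrow> reduced_strategy G i p h = Some (p h)"
  unfolding reduced_strategy_def by (auto split: if_splits)

section \<open>Mimicry and finiteness of payoffs\<close>

lemma info_less_length:
  assumes "info_less h h'" "h \<in> infosets G i" "h' \<in> infosets G i" "x \<in> h" "y \<in> h'"
  shows "length (snd x) < length (snd y)"
proof -
  obtain x' y' where xy: "x' \<in> h" "y' \<in> h'" "hist_less x' y'"
    using assms(1) unfolding info_less_def by blast
  then have "length (snd x') < length (snd y')" by (auto simp: hist_less_iff)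
  moreover have "length (snd x') = length (snd x)" "length (snd y') = length (snd y)"
    using xy assms infosets_eq infoset_length by metis+
  ultimately show ?thesis by simp
qed

text \<open>First active sets after \<open>h\<close> lie at strictly later stages, and equal stages
  pair the two plays at the same position. Copying stage by stage after \<open>h\<close> is
  therefore sufficient; it is stronger than mimicry, which starts at the first active set.\<close>

lemma mimicsI:
  assumes "x \<in> hists G"
    and "\<And>r k. r \<in> R \<Longrightarrow> length (snd x) < k \<Longrightarrow> k < horizon G \<Longrightarrow>
      s' (infoset G i (play G i s' r k)) = s (infoset G i (play G i s r k))"
  shows "mimics G i (infoset G i x) R s' s"
  unfolding mimics_def
proof (intro ballI impI)
  fix r h1 h2 h3
  assume r: "r \<in> R" and h1: "h1 \<in> first_active_after G i (infoset G i x) (the (s' (infoset G i x)))"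
    and h2: "h2 \<in> infosets G i" and h3: "h3 \<in> infosets G i"
    and c: "info_le h1 h2 \<and> passes h2 (zeta G i s' r) \<and> passes h3 (zeta G i s r) \<and>
      info_stage h2 = info_stage h3"
  obtain k where k: "k < horizon G" "play G i s' r k \<in> hists G"
    "h2 = infoset G i (play G i s' r k)" "info_stage h2 = Suc k"
    using passes_zetaE[OF h2] c by blast
  obtain n where n: "n < horizon G" "h3 = infoset G i (play G i s r n)" "info_stage h3 = Suc n"
    using passes_zetaE[OF h3] c by blast
  have h1': "h1 \<in> infosets G i" "info_less (infoset G i x) h1"
    using h1 unfolding first_active_after_def active_infosets_def info_less_def by blast+
  obtain y where y: "y \<in> h1" using h1'(1) infosetsE by blast
  have xy: "length (snd x) < length (snd y)"
    using info_less_length[OF h1'(2) infoset_in_infosets[OF assms(1)] h1'(1)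
      mem_infoset_self[OF assms(1)] y] .
  have p: "play G i s' r k \<in> h2" using k mem_infoset_self by blast
  have "length (snd y) \<le> k"
  proof (cases "h1 = h2")
    case True
    then show ?thesis using infoset_length[OF k(2)] y k(3) by simp
  next
    case False
    then have "info_less h1 h2" using c unfolding info_le_def by blast
    then show ?thesis using info_less_length[OF _ h1'(1) h2 y p] by simp
  qed
  then show "s' h2 = s h3" using assms(2)[OF r _ k(1)] xy k n c by simp
qed

text \<open>\<open>Max\<close> and \<open>Min\<close> are informative on finite sets only. There are
  finitely many terminal histories, so the strategies themselves need not be counted.\<close>

lemma finite_payoffs:
  assumes "s \<in> strategies G i" "R \<subseteq> opp_strategies G i"
  shows "finite ((\<lambda>r. payoff G i (zeta G i s r)) ` R)"
proof (rule finite_subset)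
  show "(\<lambda>r. payoff G i (zeta G i s r)) ` R \<subseteq> payoff G i ` hists_at G (horizon G)"
    using assms play_hists_at[OF assms(1), of _ "horizon G"] unfolding zeta_play by blast
qed (simp add: finite_hists_at)

end

section \<open>Outcomes of the auction\<close>

lemma assigned_iff: "assigned as \<longleftrightarrow> (\<exists>k < length as. card (bidders (as ! k)) \<le> 1)"
  unfolding assigned_def by (metis in_set_conv_nth)

lemma has_left_iff: "has_left as i \<longleftrightarrow> (\<exists>k < length as. (as ! k) i = Leave)"
  unfolding has_left_def by (metis in_set_conv_nth)

lemma has_left_take_mono: "has_left (take m as) i \<Longrightarrow> m \<le> n \<Longrightarrow> has_left (take n as) i"
  by (auto simp: has_left_iff)

lemma snd_trunc: "snd (trunc k x) = take k (snd x)"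
  by (simp add: trunc_def)

lemma auction_outcome_at:
  assumes "k < length (snd z)" "\<not> assigned (take k (snd z))" "\<not> has_left (take k (snd z)) i"
    and "card (bidders (snd z ! k)) \<le> 1"
  shows "auction_outcome lot i z =
    (if bidders (snd z ! k) = {}
     then Lottery (Suc k) (lot (Suc k) {j. \<not> has_left (take k (snd z)) j} i)
     else if i \<in> bidders (snd z ! k) then Wins (Suc k) else Nothing)"
proof -
  have "(LEAST t. t < length (snd z) \<and> card (bidders (snd z ! t)) \<le> 1) = k"
  proof (rule Least_equality)
    fix t assume t: "t < length (snd z) \<and> card (bidders (snd z ! t)) \<le> 1"
    show "k \<le> t"
    proof (rule ccontr)
      assume "\<not> k \<le> t"
      then have "assigned (take k (snd z))" using t by (auto simp: assigned_iff)
      then show False using assms(2) by blast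
    qed
  qed (use assms in simp)
  moreover have "assigned (snd z)" using assms by (auto simp: assigned_iff)
  ultimately show ?thesis using assms(3) by (simp add: auction_outcome_def Let_def)
qed

text \<open>An assignment at a position below \<open>m\<close> would show in the first
  \<open>m\<close> profiles. The resulting bound \<open>m \<le> k\<close> is what later controls the
  price paid.\<close>

lemma auction_outcome_cases:
  assumes "\<not> assigned (take m (snd z))"
  obtains "auction_outcome lot i z = Nothing"
  | k where "m \<le> k" "k < length (snd z)" "auction_outcome lot i z = Wins (Suc k)"
      "(snd z ! k) i = Bid"
  | k where "m \<le> k" "k < length (snd z)" "\<not> has_left (take k (snd z)) i"
      "auction_outcome lot i z =
        Lottery (Suc k) (lot (Suc k) {j. \<not> has_left (take k (snd z)) j} i)"
proof (cases "assigned (snd z)")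
  case False
  then show thesis using that by (simp add: auction_outcome_def)
next
  case True
  define k where "k = (LEAST t. t < length (snd z) \<and> card (bidders (snd z ! t)) \<le> 1)"
  have "\<exists>t. t < length (snd z) \<and> card (bidders (snd z ! t)) \<le> 1"
    using True by (auto simp: assigned_iff)
  from LeastI_ex[OF this] have k: "k < length (snd z)" "card (bidders (snd z ! k)) \<le> 1"
    unfolding k_def by blast+
  have "m \<le> k"
  proof (rule ccontr)
    assume "\<not> m \<le> k"
    then have "assigned (take m (snd z))" using k by (auto simp: assigned_iff)
    then show False using assms by blast
  qed
  moreover have "auction_outcome lot i z =
    (if bidders (snd z ! k) = {}
     then if \<not> has_left (take k (snd z)) i
       then Lottery (Suc k) (lot (Suc k) {j. \<not> has_left (take k (snd z)) j} i) else Nothing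
     else if i \<in> bidders (snd z ! k) then Wins (Suc k) else Nothing)"
    using True by (simp add: auction_outcome_def Let_def k_def)
  moreover have "i \<in> bidders (snd z ! k) \<longleftrightarrow> (snd z ! k) i = Bid" by (simp add: bidders_def)
  ultimately show thesis using that k(1) by (metis (no_types, lifting))
qed

section \<open>Waiting in place of bidding\<close>

definition wait_at :: "nat \<Rightarrow> 'i \<Rightarrow> ('i, 'th, move) hist \<Rightarrow> ('i, 'th, move) hist" where
  "wait_at k i y = (fst y, (snd y)[k := (snd y ! k)(i := Wait)])"

text \<open>Leaving \<open>i\<close> out of the count makes it insensitive to whether she bids or
  waits.\<close>

definition contested :: "nat \<Rightarrow> 'i \<Rightarrow> ('i, 'th, move) hist \<Rightarrow> bool" where
  "contested k i y \<longleftrightarrow> k < length (snd y) \<and> 2 \<le> card (bidders (snd y ! k) - {i})"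

lemma bidders_fun_upd_Wait: "bidders (a(i := Wait)) = bidders a - {i}"
  by (auto simp: bidders_def)

lemma nth_wait_at:
  "n < length (snd y) \<Longrightarrow>
    snd (wait_at k i y) ! n = (if n = k then (snd y ! k)(i := Wait) else snd y ! n)"
  by (simp add: wait_at_def nth_list_update)

lemma length_wait_at [simp]: "length (snd (wait_at k i y)) = length (snd y)"
  by (simp add: wait_at_def)

lemma contested_card:
  fixes y :: "('i::finite, 'th, move) hist"
  assumes "contested k i y"
  shows "\<not> card (bidders (snd y ! k)) \<le> 1"
proof -
  have "card (bidders (snd y ! k) - {i}) \<le> card (bidders (snd y ! k))"
    by (rule card_mono) auto
  then show ?thesis using assms unfolding contested_def by simp
qed

text \<open>At position \<open>k\<close> both counts exceed one, because the other bidders alone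
  number at least two; elsewhere the profiles are equal.\<close>

lemma card_bidders_wait_at:
  fixes y :: "('i::finite, 'th, move) hist"
  assumes "contested k i y" "n < length (snd y)"
  shows "card (bidders (snd (wait_at k i y) ! n)) \<le> 1 \<longleftrightarrow> card (bidders (snd y ! n)) \<le> 1"
  using assms(1) contested_card[OF assms(1)]
  by (auto simp: nth_wait_at[OF assms(2)] bidders_fun_upd_Wait contested_def)

lemma assigned_wait_at:
  fixes y :: "('i::finite, 'th, move) hist"
  assumes "contested k i y"
  shows "assigned (take n (snd (wait_at k i y))) \<longleftrightarrow> assigned (take n (snd y))"
  unfolding assigned_iff using card_bidders_wait_at[OF assms] by auto

lemma has_left_wait_at:
  assumes "contested k i y" "(snd y ! k) i \<noteq> Leave"
  shows "has_left (take n (snd (wait_at k i y))) l \<longleftrightarrow> has_left (take n (snd y)) l"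
proof -
  have "(snd (wait_at k i y) ! m) l = Leave \<longleftrightarrow> (snd y ! m) l = Leave" if "m < length (snd y)" for m
    using that assms by (auto simp: nth_wait_at)
  then show ?thesis unfolding has_left_iff by auto
qed

lemma auction_avail_wait_at:
  fixes y :: "('i::finite, 'i \<Rightarrow> int, move) hist"
  assumes "contested k i y" "(snd y ! k) i \<noteq> Leave"
  shows "auction_avail waiting l (wait_at k i y) = auction_avail waiting l y"
  using assigned_wait_at[OF assms(1), of "length (snd y)"]
    has_left_wait_at[OF assms, of "length (snd y)" l]
  by (simp add: auction_avail_def)

lemma own_actions_wait_at:
  "map (\<lambda>a. a l) (snd (wait_at k i y)) =
    (if l = i then (map (\<lambda>a. a i) (snd y))[k := Wait] else map (\<lambda>a. a l) (snd y))"
  by (rule nth_equalityI) (auto simp: nth_wait_at nth_list_update)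

text \<open>This makes the lookup in \<open>waiting_plan\<close> independent of the representative.
  Both histories are taken to be contested because \<open>i\<close> may be unable to tell one of
  them from a history with a single rival at \<open>k\<close>, where waiting would have ended the
  auction.\<close>

lemma auction_indist_wait_at:
  fixes y y' :: "('i::finite, 'i \<Rightarrow> int, move) hist"
  assumes "contested k i y" "contested k i y'" "auction_indist i y y'"
  shows "auction_indist i (wait_at k i y) (wait_at k i y')"
  using assms(3) unfolding auction_indist_def own_actions_wait_at
    assigned_wait_at[OF assms(1)] assigned_wait_at[OF assms(2)]
  by (simp add: wait_at_def)

lemma auction_indist_wait_at_other:
  fixes y :: "('i::finite, 'i \<Rightarrow> int, move) hist"
  assumes "contested k i y" "l \<noteq> i"
  shows "auction_indist l (wait_at k i y) y"
  using assms(2) unfolding auction_indist_def own_actions_wait_at assigned_wait_at[OF assms(1)]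
  by (simp add: wait_at_def)

text \<open>A contested stage decides nothing, so the deciding stage is not \<open>k\<close>; the
  deciding profile and the set of bidders eligible for the lottery are unchanged.\<close>

lemma auction_outcome_wait_at:
  fixes z :: "('i::finite, 'i \<Rightarrow> int, move) hist"
  assumes "contested k i z" "(snd z ! k) i \<noteq> Leave"
  shows "auction_outcome lot i (wait_at k i z) = auction_outcome lot i z"
proof (cases "assigned (snd z)")
  case False
  moreover have "\<not> assigned (snd (wait_at k i z))"
    using False assigned_wait_at[OF assms(1), of "length (snd z)"] by simp
  ultimately show ?thesis by (simp add: auction_outcome_def)
next
  case True
  let ?w = "wait_at k i z"
  define t where "t = (LEAST t. t < length (snd z) \<and> card (bidders (snd z ! t)) \<le> 1)"
  have least: "(LEAST t. t < length (snd ?w) \<and> card (bidders (snd ?w ! t)) \<le> 1) = t"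
    unfolding t_def using card_bidders_wait_at[OF assms(1)] by (intro arg_cong[where f = Least]) auto
  have "\<exists>t. t < length (snd z) \<and> card (bidders (snd z ! t)) \<le> 1"
    using True by (auto simp: assigned_iff)
  from LeastI_ex[OF this] have t: "t < length (snd z)" "card (bidders (snd z ! t)) \<le> 1"
    unfolding t_def by blast+
  then have "t \<noteq> k" using contested_card[OF assms(1)] by auto
  then have "snd ?w ! t = snd z ! t" using t by (simp add: nth_wait_at)
  moreover have "assigned (snd ?w)" using True assigned_wait_at[OF assms(1), of "length (snd z)"] by simp
  ultimately show ?thesis
    using True unfolding auction_outcome_def Let_def least t_def[symmetric]
    by (simp add: has_left_wait_at[OF assms])
qed

section \<open>Payoffs in the auction\<close>

locale ascending_auction =
  fixes \<Theta> :: "('i::finite \<Rightarrow> int) set"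
    and T :: nat
    and waiting :: bool
    and lot :: "nat \<Rightarrow> 'i set \<Rightarrow> 'i \<Rightarrow> real"
    and lpay :: "'i \<Rightarrow> int \<Rightarrow> nat \<Rightarrow> real \<Rightarrow> real"
  assumes finite_valuations: "finite \<Theta>" and valuations_nonempty: "\<Theta> \<noteq> {}"
    and valuation_less: "\<And>\<theta> i. \<theta> \<in> \<Theta> \<Longrightarrow> \<theta> i < int T"
    and two_stages: "2 \<le> T"
    and valuation_ge_1: "\<And>\<theta> i. waiting \<Longrightarrow> \<theta> \<in> \<Theta> \<Longrightarrow> 1 \<le> \<theta> i"
    and lot_nonneg: "\<And>p R i. i \<in> R \<Longrightarrow> 0 \<le> lot p R i"
    and lot_sum: "\<And>p R. R \<noteq> {} \<Longrightarrow> (\<Sum>i\<in>R. lot p R i) = 1"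
    and lpay_bounds: "\<And>i v p q. 0 \<le> q \<Longrightarrow> q \<le> 1 \<Longrightarrow>
      min 0 (of_int v - of_nat p) \<le> lpay i v p q \<and> lpay i v p q \<le> max 0 (of_int v - of_nat p)"
begin

abbreviation auc :: "('i, 'i \<Rightarrow> int, move, result) game" where
  "auc \<equiv> auction waiting \<Theta> T lot lpay"

lemma auction_sel [simp]:
  "nature auc = \<Theta>" "horizon auc = T" "avail auc = auction_avail waiting"
  "indist auc = auction_indist" "outcome auc = auction_outcome lot"
  "payoff auc = auction_payoff lot lpay"
  by (simp_all add: auction_def)

sublocale multistage auc
  using finite_valuations valuations_nonempty two_stages
  by unfold_locales (rule multistage_game_auction, simp_all)

lemma lot_le_1: "i \<in> R \<Longrightarrow> lot p R i \<le> 1"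
proof -
  assume i: "i \<in> R"
  have "lot p R i \<le> (\<Sum>j\<in>R. lot p R j)"
    by (rule member_le_sum) (use i lot_nonneg in simp_all)
  moreover have "R \<noteq> {}" using i by blast
  ultimately show ?thesis by (simp add: lot_sum)
qed

lemma payoff_lottery:
  assumes "auction_outcome lot i z = Lottery p (lot p R i)" "i \<in> R"
  shows "min 0 (of_int (fst z i) - of_nat p) \<le> payoff auc i z"
    and "payoff auc i z \<le> max 0 (of_int (fst z i) - of_nat p)"
  using lpay_bounds[of "lot p R i" "fst z i" p i] lot_nonneg[OF assms(2), of p]
    lot_le_1[OF assms(2), of p] assms(1)
  by (simp_all add: auction_payoff_def)

text \<open>With nothing assigned in the first \<open>m\<close> stages, every possible price is at
  least \<open>Suc m\<close> and hence not below the valuation.\<close>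

lemma payoff_nonpos:
  assumes "\<not> assigned (take m (snd z))" "fst z i \<le> int (Suc m)"
  shows "payoff auc i z \<le> 0"
  using assms(1)
proof (cases rule: auction_outcome_cases[where lot = lot and i = i])
  case 1
  then show ?thesis by (simp add: auction_payoff_def)
next
  case (2 k)
  then show ?thesis using assms(2) by (simp add: auction_payoff_def)
next
  case (3 k)
  have "payoff auc i z \<le> max 0 (of_int (fst z i) - of_nat (Suc k))"
    using 3 payoff_lottery(2)[OF 3(4)] by simp
  then show ?thesis using 3(1) assms(2) by simp
qed

lemma hists_at_left:
  assumes "z \<in> hists_at auc n" "k < n" "has_left (take k (snd z)) i"
  shows "(snd z ! k) i = Leave"
proof -
  have "(snd z ! k) i \<in> auction_avail waiting i (trunc k z)"
    using assms(1,2) unfolding hists_at_iff by simp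
  then show ?thesis using assms(3) by (simp add: auction_avail_def snd_trunc)
qed

text \<open>A bidder who has left can neither bid again nor belong to the set among which the object
  is drawn.\<close>

lemma payoff_left:
  assumes "z \<in> hists_at auc n" "\<not> assigned (take m (snd z))" "has_left (take m (snd z)) i"
  shows "payoff auc i z = 0"
  using assms(2)
proof (cases rule: auction_outcome_cases[where lot = lot and i = i])
  case 1
  then show ?thesis by (simp add: auction_payoff_def)
next
  case (2 k)
  then show ?thesis
    using hists_at_left[OF assms(1), of k i] has_left_take_mono[OF assms(3) 2(1)] assms(1)
    by (simp add: hists_at_iff)
next
  case (3 k)
  then show ?thesis using has_left_take_mono[OF assms(3) 3(1)] by blast
qed

text \<open>The lottery is held among those who have not left before the stage, so a bidder who
  leaves at \<open>m\<close> may still win it there. At this price, not above her valuation, that is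
  no loss, and later stages exclude her.\<close>

lemma payoff_leave:
  assumes "z \<in> hists_at auc n" "\<not> assigned (take m (snd z))" "m < n" "(snd z ! m) i = Leave"
    and "int (Suc m) \<le> fst z i"
  shows "0 \<le> payoff auc i z"
  using assms(2)
proof (cases rule: auction_outcome_cases[where lot = lot and i = i])
  case 1
  then show ?thesis by (simp add: auction_payoff_def)
next
  case (2 k)
  then have "k \<noteq> m" using assms(4) by auto
  then have "has_left (take k (snd z)) i"
    using 2 assms(4) by (auto simp: has_left_iff intro!: exI[of _ m])
  then show ?thesis using hists_at_left[OF assms(1), of k i] 2 assms(1) by (simp add: hists_at_iff)
next
  case (3 k)
  then have "k = m"
    using assms(4) by (auto simp: has_left_iff dest!: spec[of _ m])
  then have "min 0 (of_int (fst z i) - of_nat (Suc m)) \<le> payoff auc i z"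
    using payoff_lottery(1)[OF 3(4)] 3(3) by simp
  then show ?thesis using assms(5) by simp
qed

lemma active_infoset_iff:
  assumes "x \<in> hists auc"
  shows "infoset auc i x \<in> active_infosets auc i \<longleftrightarrow> \<not> assigned (snd x) \<and> \<not> has_left (snd x) i"
  using infoset_in_infosets[OF assms, of i]
  by (auto simp: active_infosets_def acts_infoset[OF assms] auction_avail_def)

lemma Leave_acts: "h \<in> infosets auc i \<Longrightarrow> Leave \<in> acts auc i h"
  by (erule infosetsE) (simp add: acts_infoset auction_avail_def)

lemma infoset_cong:
  "auction_indist i x y \<Longrightarrow> infoset auc i x = infoset auc i y"
  unfolding infoset_def by (auto simp: auction_indist_def)

end

section \<open>Local dominance at a decision node\<close>

text \<open>The last stage is excluded because no active set can follow it, so that endings there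
  would not be determined by the number of bids. Prices up to the valuation never fall on it,
  valuations being below \<open>T\<close>.\<close>

locale decision_node = ascending_auction +
  fixes i and x
  assumes hist: "x \<in> hists auc"
    and unassigned: "\<not> assigned (snd x)"
    and not_left: "\<not> has_left (snd x) i"
    and next_stage: "Suc (length (snd x)) < T"
begin

abbreviation "k \<equiv> length (snd x)"

abbreviation "h \<equiv> infoset auc i x"

abbreviation "v \<equiv> fst x i"

lemma h_infoset: "h \<in> infosets auc i"
  using hist by (rule infoset_in_infosets)

section \<open>Plays through the decision node\<close>

lemma zeta_hists_at:
  assumes "s \<in> strategies_allowing auc i h" "r \<in> opp_allowing auc i h"
  shows "zeta auc i s r \<in> hists_at auc T"
  using play_hists_at[of s i r T] assms opp_allowingD(1)[OF hist assms(2)]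
  unfolding zeta_play strategies_allowing_def by simp

lemma zeta_reaches:
  assumes "s \<in> strategies_allowing auc i h" "r \<in> opp_allowing auc i h"
  shows "\<not> assigned (take k (snd (zeta auc i s r)))"
    and "\<not> has_left (take k (snd (zeta auc i s r))) i"
    and "fst (zeta auc i s r) i = v"
    and "length (snd (zeta auc i s r)) = T"
proof -
  let ?y = "play auc i s r k"
  have y: "?y \<in> h" using opp_allowingD(2)[OF hist assms(2,1)] .
  then have "infoset auc i ?y = h" "?y \<in> hists auc" using infosets_eq[OF h_infoset] by blast+
  then have "\<not> assigned (snd ?y) \<and> \<not> has_left (snd ?y) i"
    using active_infoset_iff[of ?y i] active_infoset_iff[OF hist, of i] unassigned not_left by simp
  moreover have "take k (snd (zeta auc i s r)) = snd ?y"
    using next_stage unfolding zeta_play snd_trunc[symmetric] by simp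
  ultimately show "\<not> assigned (take k (snd (zeta auc i s r)))"
    "\<not> has_left (take k (snd (zeta auc i s r))) i" by simp_all
  show "fst (zeta auc i s r) i = v"
    using mem_infosetD[OF y] unfolding zeta_play by (simp add: auction_indist_def)
  show "length (snd (zeta auc i s r)) = T" by (simp add: zeta_play)
qed

lemma choosing_allowing:
  "s \<in> strategies_choosing auc i h a \<Longrightarrow> s \<in> strategies_allowing auc i h"
  "s \<in> strategies_choosing auc i h a \<Longrightarrow> s \<in> strategies auc i"
  unfolding strategies_choosing_def strategies_allowing_def by blast+

lemma zeta_own_action:
  assumes "s \<in> strategies_choosing auc i h a" "r \<in> opp_allowing auc i h"
  shows "(snd (zeta auc i s r) ! k) i = a"
proof -
  have "infoset auc i (play auc i s r k) = h"
    using opp_allowingD(2)[OF hist assms(2) choosing_allowing(1)[OF assms(1)]]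
      infosets_eq(1)[OF h_infoset] by blast
  moreover have "s h = Some a" using assms(1) unfolding strategies_choosing_def by blast
  ultimately show ?thesis
    using next_stage unfolding zeta_play by (simp add: nth_play_own)
qed

lemma zeta_other_action:
  assumes "s \<in> strategies_allowing auc i h" "s' \<in> strategies_allowing auc i h"
    and "r \<in> opp_allowing auc i h" "l \<noteq> i"
  shows "(snd (zeta auc i s' r) ! k) l = (snd (zeta auc i s r) ! k) l"
  using next_stage assms(4) opp_allowingD(3)[OF hist assms(3,1,2)]
  unfolding zeta_play by (simp add: nth_play_other)

lemma zeta_other_bidders:
  assumes "s \<in> strategies_allowing auc i h" "s' \<in> strategies_allowing auc i h"
    and "r \<in> opp_allowing auc i h"
  shows "bidders (snd (zeta auc i s' r) ! k) - {i} = bidders (snd (zeta auc i s r) ! k) - {i}"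
  using zeta_other_action[OF assms] unfolding bidders_def by auto

text \<open>If \<open>i\<close> stays in and at least two players bid, the information set one stage
  later is active; otherwise all later ones offer only \<open>Leave\<close>. A condition on every
  continuation thus becomes a count of bids at \<open>k\<close>.\<close>

lemma opp_ending_iff:
  assumes s: "s \<in> strategies_choosing auc i h a" and r: "r \<in> opp_allowing auc i h"
  shows "r \<in> opp_ending auc i h a \<longleftrightarrow> a = Leave \<or> card (bidders (snd (zeta auc i s r) ! k)) \<le> 1"
proof
  assume e: "r \<in> opp_ending auc i h a"
  show "a = Leave \<or> card (bidders (snd (zeta auc i s r) ! k)) \<le> 1"
  proof (rule ccontr)
    assume c: "\<not> (a = Leave \<or> card (bidders (snd (zeta auc i s r) ! k)) \<le> 1)"
    let ?z = "zeta auc i s r" and ?y = "play auc i s r (Suc k)"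
    have sa: "s \<in> strategies_allowing auc i h" "s \<in> strategies auc i"
      using choosing_allowing[OF s] by blast+
    have y: "?y \<in> hists auc"
      using play_hists[OF sa(2) opp_allowingD(1)[OF hist r]] next_stage by simp
    have yz: "snd ?y = take (Suc k) (snd ?z)"
      using next_stage unfolding zeta_play snd_trunc[symmetric] by simp
    have "\<not> assigned (snd ?y)"
      using zeta_reaches(1)[OF sa(1) r] zeta_reaches(4)[OF sa(1) r] c
      unfolding yz by (auto simp: assigned_iff less_Suc_eq)
    moreover have "\<not> has_left (snd ?y) i"
      using zeta_reaches(2)[OF sa(1) r] zeta_reaches(4)[OF sa(1) r] c zeta_own_action[OF s r]
      unfolding yz by (auto simp: has_left_iff less_Suc_eq)
    ultimately have "infoset auc i ?y \<in> active_infosets auc i"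
      using active_infoset_iff[OF y] by blast
    moreover have "info_less h (infoset auc i ?y)"
      unfolding info_less_def
    proof (intro bexI)
      show "hist_less (play auc i s r k) ?y"
        unfolding hist_less_iff by (intro exI[of _ k]) simp
      show "?y \<in> infoset auc i ?y" using mem_infoset_self[OF y] .
      show "play auc i s r k \<in> h" using opp_allowingD(2)[OF hist r sa(1)] .
    qed
    moreover have "passes (infoset auc i ?y) ?z"
      using mem_infoset_self[OF y, of i] unfolding passes_zeta_iff[OF y] by simp
    moreover have "?z \<in> outcomes_after auc i h a r" using s unfolding outcomes_after_def by blast
    ultimately show False using e unfolding opp_ending_def by blast
  qed
next
  assume a: "a = Leave \<or> card (bidders (snd (zeta auc i s r) ! k)) \<le> 1"
  have "\<not> (\<exists>h'\<in>active_infosets auc i. info_less h h' \<and> passes h' (zeta auc i t r))"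
    if t: "t \<in> strategies_choosing auc i h a" for t
  proof
    assume "\<exists>h'\<in>active_infosets auc i. info_less h h' \<and> passes h' (zeta auc i t r)"
    then obtain h' where h': "h' \<in> active_infosets auc i" "info_less h h'"
      "passes h' (zeta auc i t r)" by blast
    then have i': "h' \<in> infosets auc i" unfolding active_infosets_def by blast
    obtain n where n: "n < horizon auc" "play auc i t r n \<in> hists auc"
      "h' = infoset auc i (play auc i t r n)"
      using passes_zetaE[OF i' h'(3)] by blast
    let ?y = "play auc i t r n"
    have "k < length (snd ?y)"
      using info_less_length[OF h'(2) h_infoset i' mem_infoset_self[OF hist]]
        mem_infoset_self[OF n(2), of i] n(3) by blast
    then have "k < n" by simp
    moreover have "snd ?y = take n (snd (zeta auc i t r))"
      using n(1) unfolding zeta_play snd_trunc[symmetric] by simp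
    ultimately have yk: "snd ?y ! k = snd (zeta auc i t r) ! k" by simp
    \<comment> \<open>The opponents move at \<open>k\<close> before they can react to anything after
      \<open>h\<close>, so the count taken with \<open>s\<close> is valid for every \<open>t\<close>
      that chooses \<open>a\<close>.\<close>
    have eq: "bidders (snd (zeta auc i t r) ! k) = bidders (snd (zeta auc i s r) ! k)"
      using zeta_other_action[OF choosing_allowing(1)[OF s] choosing_allowing(1)[OF t] r]
        zeta_own_action[OF s r] zeta_own_action[OF t r]
      unfolding bidders_def by metis
    have "assigned (snd ?y) \<or> has_left (snd ?y) i"
      using a eq yk zeta_own_action[OF t r] \<open>k < n\<close>
      unfolding assigned_iff has_left_iff by (metis length_play)
    then show False using h'(1) active_infoset_iff[OF n(2), of i] n(3) by blast
  qed
  then show "r \<in> opp_ending auc i h a"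
    using r unfolding opp_ending_def outcomes_after_def by blast
qed

lemma opp_ending_allowing: "r \<in> opp_ending auc i h a \<Longrightarrow> r \<in> opp_allowing auc i h"
  unfolding opp_ending_def by blast

lemma finite_payoffs_allowing:
  assumes "s \<in> strategies_choosing auc i h a" "R \<subseteq> opp_allowing auc i h"
  shows "finite ((\<lambda>r. payoff auc i (zeta auc i s r)) ` R)"
  using assms finite_payoffs[OF choosing_allowing(2)[OF assms(1)], of R] opp_allowingD(1)[OF hist]
  by blast

text \<open>The fallback \<open>Leave\<close> is available at every information set, so any \<open>q\<close> yields a
  strategy.\<close>

definition deviation_plan where
  "deviation_plan s a' q h' =
     (let a = if h' = h then a' else if stage x < info_stage h' then q h' else the (s h')
      in if a \<in> acts auc i h' then a else Leave)"

definition deviation where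
  "deviation s a' q = reduced_strategy auc i (deviation_plan s a' q)"

lemma deviation_strategies: "deviation s a' q \<in> strategies auc i"
  unfolding deviation_def
  by (rule reduced_strategy_strategies) (simp add: deviation_plan_def Let_def Leave_acts)

text \<open>Before \<open>h\<close> the plan repeats \<open>s\<close>, whose actions are those
  recorded in \<open>x\<close>. The deviation is thus consistent with \<open>x\<close>, which puts
  \<open>h\<close> in its domain.\<close>

lemma deviation_choosing:
  assumes "s \<in> strategies_choosing auc i h a" "a' \<in> acts auc i h"
  shows "deviation s a' q \<in> strategies_choosing auc i h a'"
proof -
  let ?d = "deviation s a' q"
  have "deviation_plan s a' q (infoset auc i (trunc j x)) = (snd x ! j) i" if j: "j < k" for j
  proof -
    have t: "trunc j x \<in> hists auc"
      using trunc_hists[of x auc k j] j hist by (simp add: hists_iff)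
    have "info_stage (infoset auc i (trunc j x)) = Suc j" "info_stage h = Suc k"
      using info_stage_infoset[OF t] info_stage_infoset[OF hist] j by (simp_all add: stage_def)
    moreover have "s (infoset auc i (trunc j x)) = Some ((snd x ! j) i)"
      using allowing_consistent[OF hist choosing_allowing(1)[OF assms(1)] j] .
    moreover have "(snd x ! j) i \<in> acts auc i (infoset auc i (trunc j x))"
      using hist j unfolding acts_infoset[OF t] hists_iff hists_at_iff by blast
    ultimately show ?thesis using j unfolding deviation_plan_def Let_def by (auto simp: stage_def)
  qed
  then have cons: "consistent auc i ?d x"
    unfolding deviation_def reduced_strategy_consistent[OF hist] by blast
  have "?d (infoset auc i (trunc j x)) = s (infoset auc i (trunc j x))" if "j < k" for j
    using that cons allowing_consistent[OF hist choosing_allowing(1)[OF assms(1)]]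
    unfolding consistent_def by simp
  then have "?d \<in> strategies_allowing auc i h"
    by (rule strategies_allowing_deviation[OF hist choosing_allowing(1)[OF assms(1)]
        deviation_strategies])
  moreover have "?d h = Some a'"
  proof -
    have "?d h \<noteq> None"
      using strategies_defined[OF deviation_strategies h_infoset mem_infoset_self[OF hist] cons]
      by auto
    then have "?d h = Some (deviation_plan s a' q h)"
      unfolding deviation_def by (rule reduced_strategy_eq)
    then show ?thesis using assms(2) by (simp add: deviation_plan_def)
  qed
  ultimately show ?thesis unfolding strategies_choosing_def by blast
qed

lemma deviation_after:
  fixes s a' q
  assumes "r \<in> opp_strategies auc i" "k < n" "n < T"
  defines "y \<equiv> play auc i (deviation s a' q) r n"
  shows "deviation s a' q (infoset auc i y) =
    Some (if q (infoset auc i y) \<in> auction_avail waiting i y then q (infoset auc i y) else Leave)"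
proof -
  have y: "y \<in> hists auc"
    using play_hists[OF deviation_strategies assms(1)] assms(3) unfolding y_def by simp
  have st: "info_stage (infoset auc i y) = Suc n" "info_stage h = Suc k"
    using info_stage_infoset[OF y] info_stage_infoset[OF hist] by (simp_all add: stage_def y_def)
  then have ne: "infoset auc i y \<noteq> h" using assms(2) by auto
  have "deviation s a' q (infoset auc i y) \<noteq> None"
    using play_action[OF deviation_strategies assms(1), of n "Suc n"] assms(3)
    unfolding y_def by simp
  then have "deviation s a' q (infoset auc i y) = Some (deviation_plan s a' q (infoset auc i y))"
    unfolding deviation_def by (rule reduced_strategy_eq)
  then show ?thesis
    using assms(2) ne st
    by (simp add: deviation_plan_def Let_def acts_infoset[OF y] stage_def)
qed

lemma deviation_Leave_after:
  assumes "r \<in> opp_strategies auc i" "k < n" "n < T"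
  shows "deviation s a' (\<lambda>_. Leave) (infoset auc i (play auc i (deviation s a' (\<lambda>_. Leave)) r n))
    = Some Leave"
  using deviation_after[OF assms, of s a' "\<lambda>_. Leave"] by simp

text \<open>After an ending action every later information set of \<open>s\<close> is inactive, and
  there \<open>Leave\<close> is the only move. The deviation plays \<open>Leave\<close> as well,
  even where it is still active itself.\<close>

lemma mimics_Leave_deviation:
  assumes s: "s \<in> strategies_choosing auc i h a" and R: "R \<subseteq> opp_ending auc i h a"
  shows "mimics auc i h R (deviation s a' (\<lambda>_. Leave)) s"
proof (rule mimicsI[OF hist])
  fix r n assume r: "r \<in> R" and n: "k < n" "n < horizon auc"
  have ra: "r \<in> opp_allowing auc i h" using R r opp_ending_allowing by blast
  have ro: "r \<in> opp_strategies auc i" using opp_allowingD(1)[OF hist ra] .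
  have ss: "s \<in> strategies auc i" using choosing_allowing(2)[OF s] .
  let ?y = "play auc i s r n"
  have y: "?y \<in> hists auc" using play_hists[OF ss ro n(2)] .
  have "info_less h (infoset auc i ?y)"
    unfolding info_less_def
  proof (intro bexI)
    show "hist_less (play auc i s r k) ?y"
      unfolding hist_less_iff using n by (intro exI[of _ k]) simp
    show "?y \<in> infoset auc i ?y" using mem_infoset_self[OF y] .
    show "play auc i s r k \<in> h"
      using opp_allowingD(2)[OF hist ra choosing_allowing(1)[OF s]] .
  qed
  moreover have "passes (infoset auc i ?y) (zeta auc i s r)"
    using mem_infoset_self[OF y, of i] unfolding passes_zeta_iff[OF y] by simp
  moreover have "zeta auc i s r \<in> outcomes_after auc i h a r"
    using s unfolding outcomes_after_def by blast
  ultimately have "infoset auc i ?y \<notin> active_infosets auc i"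
    using R r unfolding opp_ending_def by blast
  then have "auction_avail waiting i ?y = {Leave}"
    unfolding active_infoset_iff[OF y] by (auto simp: auction_avail_def)
  moreover have "(snd (play auc i s r (Suc n)) ! n) i \<in> avail auc i ?y"
    using play_avail[OF ss ro, of n "Suc n"] n by simp
  ultimately have "s (infoset auc i ?y) = Some Leave"
    using play_action[OF ss ro, of n "Suc n"] n by simp
  then show "deviation s a' (\<lambda>_. Leave)
      (infoset auc i (play auc i (deviation s a' (\<lambda>_. Leave)) r n)) = s (infoset auc i ?y)"
    using deviation_Leave_after[OF ro n(1)] n(2) by simp
qed

text \<open>Leaving is irreversible; mimicry is therefore vacuous for strategies that choose
  \<open>Leave\<close> at \<open>h\<close>.\<close>

lemma first_active_after_Leave: "first_active_after auc i h Leave = {}"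
proof -
  have False if "h' \<in> active_infosets auc i" "y \<in> h" "y' \<in> h'" "hist_less y y'"
    "(snd y' ! length (snd y)) i = Leave" for h' y y'
  proof -
    have h': "h' \<in> infosets auc i" using that(1) unfolding active_infosets_def by blast
    have y': "y' \<in> hists auc" "h' = infoset auc i y'" using infosets_eq[OF h' that(3)] by blast+
    have "length (snd y) < length (snd y')" using that(4) by (auto simp: hist_less_iff)
    then have "has_left (snd y') i" using that(5) by (auto simp: has_left_iff)
    then show False using that(1) active_infoset_iff[OF y'(1), of i] y'(2) by blast
  qed
  then show ?thesis unfolding first_active_after_def by blast
qed

text \<open>Having bid, \<open>i\<close> sees that the auction goes on but not how many rivals bid.
  The plan picks a contested history in the set, replaces the bid by waiting and does what
  \<open>s\<close> does there. \<open>Leave\<close> is a placeholder on sets to which opponents with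
  two bids at \<open>h\<close> never lead.\<close>

definition waiting_plan where
  "waiting_plan s h' =
     (if \<exists>y\<in>h'. contested k i y
      then the (s (infoset auc i (wait_at k i (SOME y. y \<in> h' \<and> contested k i y)))) else Leave)"

lemma waiting_plan_infoset:
  assumes "y \<in> hists auc" "contested k i y"
  shows "waiting_plan s (infoset auc i y) = the (s (infoset auc i (wait_at k i y)))"
proof -
  let ?y' = "SOME y'. y' \<in> infoset auc i y \<and> contested k i y'"
  have self: "y \<in> infoset auc i y \<and> contested k i y" using assms mem_infoset_self by blast
  then have y': "?y' \<in> infoset auc i y \<and> contested k i ?y'" by (rule someI)
  then have "auction_indist i y ?y'" using mem_infosetD by fastforce
  then have "infoset auc i (wait_at k i y) = infoset auc i (wait_at k i ?y')"
    using y' assms(2) by (intro infoset_cong auction_indist_wait_at) auto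
  then show ?thesis using self unfolding waiting_plan_def by auto
qed

text \<open>If at least two opponents bid at \<open>h\<close>, no opponent can tell bidding from waiting.\<close>

lemma play_waiting_plan:
  assumes s: "s \<in> strategies_choosing auc i h Wait" and bid: "Bid \<in> acts auc i h"
    and r: "r \<in> opp_allowing auc i h"
    and two: "2 \<le> card (bidders (snd (zeta auc i s r) ! k) - {i})"
    and n: "k < n" "n \<le> T"
  defines "s' \<equiv> deviation s Bid (waiting_plan s)"
  shows "contested k i (play auc i s' r n)"
    and "(snd (play auc i s' r n) ! k) i = Bid"
    and "play auc i s r n = wait_at k i (play auc i s' r n)"
    and "n < T \<Longrightarrow> s' (infoset auc i (play auc i s' r n)) = s (infoset auc i (play auc i s r n))"
proof -
  have s'c: "s' \<in> strategies_choosing auc i h Bid"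
    unfolding s'_def using deviation_choosing[OF s bid] .
  have sa: "s \<in> strategies_allowing auc i h" "s \<in> strategies auc i"
    and s'a: "s' \<in> strategies_allowing auc i h" "s' \<in> strategies auc i"
    using choosing_allowing[OF s] choosing_allowing[OF s'c] by blast+
  have ro: "r \<in> opp_strategies auc i" using opp_allowingD(1)[OF hist r] .
  have nth: "snd (play auc i t r m) ! k = snd (zeta auc i t r) ! k" if "k < m" "m \<le> T" for t m
  proof -
    have "snd (play auc i t r m) = take m (snd (zeta auc i t r))"
      using that unfolding zeta_play snd_trunc[symmetric] by simp
    then show ?thesis using that by simp
  qed
  have bid_at: "(snd (play auc i s' r m) ! k) i = Bid" if "k < m" "m \<le> T" for m
    using nth[OF that] zeta_own_action[OF s'c r] by simp
  have cont: "contested k i (play auc i s' r m)" if "k < m" "m \<le> T" for m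
    using that two unfolding contested_def nth[OF that]
    by (simp add: zeta_other_bidders[OF sa(1) s'a(1) r])
  have act: "s' (infoset auc i (play auc i s' r m)) = s (infoset auc i (play auc i s r m))"
    if m: "k < m" "m < T" and eq: "play auc i s r m = wait_at k i (play auc i s' r m)" for m
  proof -
    let ?y = "play auc i s' r m"
    have y: "?y \<in> hists auc" using play_hists[OF s'a(2) ro] m by simp
    have c: "contested k i ?y" "(snd ?y ! k) i \<noteq> Leave" using cont bid_at m by simp_all
    have wp: "waiting_plan s (infoset auc i ?y) = the (s (infoset auc i (play auc i s r m)))"
      using waiting_plan_infoset[OF y c(1)] eq by simp
    have sm: "s (infoset auc i (play auc i s r m)) = Some ((snd (play auc i s r (Suc m)) ! m) i)"
      using play_action[OF sa(2) ro, of m "Suc m"] m by simp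
    have "(snd (play auc i s r (Suc m)) ! m) i \<in> auction_avail waiting i (play auc i s r m)"
      using play_avail[OF sa(2) ro, of m "Suc m"] m by simp
    \<comment> \<open>Both histories offer \<open>i\<close> the same actions, so the copied move is
      available and the deviation does not resort to its fallback \<open>Leave\<close>.\<close>
    then have "the (s (infoset auc i (play auc i s r m))) \<in> auction_avail waiting i ?y"
      using sm unfolding eq auction_avail_wait_at[OF c] by simp
    then show ?thesis
      using deviation_after[OF ro m, of s Bid "waiting_plan s"] wp sm unfolding s'_def by simp
  qed
  \<comment> \<open>The plays coincide up to \<open>k\<close>, so the correspondence starts after
    the move at \<open>h\<close>. It is interlocked with the copying: \<open>act\<close> at stage
    \<open>m\<close> presupposes it at \<open>m\<close> and yields it at
    \<open>Suc m\<close>.\<close>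
  have eq: "play auc i s r m = wait_at k i (play auc i s' r m)" if "Suc k \<le> m" "m \<le> T" for m
    using that
  proof (induction m rule: dec_induct)
    case base
    have pk: "play auc i s r k = play auc i s' r k" using opp_allowingD(3)[OF hist r s'a(1) sa(1)] .
    have h: "infoset auc i (play auc i s' r k) = h"
      using infosets_eq(1)[OF h_infoset opp_allowingD(2)[OF hist r s'a(1)]] by simp
    have "s h = Some Wait" using s unfolding strategies_choosing_def by blast
    then show ?case
      unfolding play_Suc pk wait_at_def h
      using list_update_length[of "snd (play auc i s' r k)"]
      by (auto simp: nth_append fun_eq_iff h)
  next
    case (step m)
    then have m: "k < m" "m < T" and IH: "play auc i s r m = wait_at k i (play auc i s' r m)" by simp_all
    \<comment> \<open>The others record their own moves and the assignment status, neither of which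
      \<open>wait_at\<close> alters; hence they respond alike in both plays.\<close>
    have "infoset auc l (play auc i s r m) = infoset auc l (play auc i s' r m)" if "l \<noteq> i" for l
      unfolding IH using cont m that by (intro infoset_cong auction_indist_wait_at_other) simp_all
    then have "(if l = i then s else snd r l) (infoset auc l (play auc i s r m)) =
        (if l = i then s' else snd r l) (infoset auc l (play auc i s' r m))" for l
      using act[OF m IH] by auto
    moreover have "snd (play auc i s r m) = (snd (play auc i s' r m))
        [k := (snd (play auc i s' r m) ! k)(i := Wait)]"
      unfolding IH by (simp add: wait_at_def)
    ultimately show ?case
      unfolding play_Suc wait_at_def
      using m by (simp add: list_update_append1 nth_append)
  qed
  show "contested k i (play auc i s' r n)" "(snd (play auc i s' r n) ! k) i = Bid"
    using cont bid_at n by blast+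
  show e: "play auc i s r n = wait_at k i (play auc i s' r n)" using eq n by simp
  show "n < T \<Longrightarrow> s' (infoset auc i (play auc i s' r n)) = s (infoset auc i (play auc i s r n))"
    using act[OF n(1) _ e] .
qed

section \<open>Payoffs by the number of rivals\<close>

definition rivals where
  "rivals s r = bidders (snd (zeta auc i s r) ! k) - {i}"

text \<open>The strategy argument of \<open>rivals\<close> serves only to compute the play; the
  rivals are a feature of the opponents.\<close>

lemma rivals_eq:
  assumes "s \<in> strategies_choosing auc i h a" "s' \<in> strategies_choosing auc i h a'"
    and "r \<in> opp_allowing auc i h"
  shows "rivals s' r = rivals s r"
  unfolding rivals_def
  using zeta_other_bidders[OF choosing_allowing(1)[OF assms(1)] choosing_allowing(1)[OF assms(2)]
      assms(3)] .

lemma zeta_bidders: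
  assumes "s \<in> strategies_choosing auc i h a" "r \<in> opp_allowing auc i h"
  shows "bidders (snd (zeta auc i s r) ! k) = (if a = Bid then insert i (rivals s r) else rivals s r)"
  using zeta_own_action[OF assms] unfolding rivals_def by (auto simp: bidders_def)

lemma not_in_rivals: "i \<notin> rivals s r"
  by (simp add: rivals_def)

text \<open>A bid adds one to the count, so bidding ends only without rivals while waiting also ends
  with a single one.\<close>

lemma opp_ending_rivals:
  assumes "s \<in> strategies_choosing auc i h a" "r \<in> opp_allowing auc i h"
  shows "r \<in> opp_ending auc i h a \<longleftrightarrow>
    a = Leave \<or> (if a = Bid then rivals s r = {} else card (rivals s r) \<le> 1)"
  using not_in_rivals[of s r]
  by (auto simp: opp_ending_iff[OF assms] zeta_bidders[OF assms])

lemma zeta_outcome: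
  assumes "s \<in> strategies_choosing auc i h a" "r \<in> opp_allowing auc i h"
    and "card (bidders (snd (zeta auc i s r) ! k)) \<le> 1"
  defines "z \<equiv> zeta auc i s r"
  shows "auction_outcome lot i z =
    (if bidders (snd z ! k) = {}
     then Lottery (Suc k) (lot (Suc k) {j. \<not> has_left (take k (snd z)) j} i)
     else if i \<in> bidders (snd z ! k) then Wins (Suc k) else Nothing)"
  using zeta_reaches[OF choosing_allowing(1)[OF assms(1)] assms(2)] assms(3) next_stage
  unfolding z_def by (intro auction_outcome_at) simp_all

text \<open>Leaving and waiting are treated alike, since a departure at the current stage does not
  yet remove \<open>i\<close> from the lottery.\<close>

lemma payoff_no_bid:
  assumes "s \<in> strategies_choosing auc i h a" "r \<in> opp_allowing auc i h"
    and "a \<noteq> Bid" "rivals s r = {}"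
  shows "min 0 (of_int v - of_nat (Suc k)) \<le> payoff auc i (zeta auc i s r)"
    and "payoff auc i (zeta auc i s r) \<le> max 0 (of_int v - of_nat (Suc k))"
proof -
  let ?z = "zeta auc i s r"
  note reach = zeta_reaches[OF choosing_allowing(1)[OF assms(1)] assms(2)]
  have b: "bidders (snd ?z ! k) = {}" using assms(3,4) by (simp add: zeta_bidders[OF assms(1,2)])
  then have "auction_outcome lot i ?z =
      Lottery (Suc k) (lot (Suc k) {j. \<not> has_left (take k (snd ?z)) j} i)"
    using zeta_outcome[OF assms(1,2)] by simp
  from payoff_lottery[OF this] reach(2,3)
  show "min 0 (of_int v - of_nat (Suc k)) \<le> payoff auc i (zeta auc i s r)"
    "payoff auc i (zeta auc i s r) \<le> max 0 (of_int v - of_nat (Suc k))"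
    by simp_all
qed

lemma payoff_sole_bidder:
  assumes "s \<in> strategies_choosing auc i h Bid" "r \<in> opp_allowing auc i h" "rivals s r = {}"
  shows "payoff auc i (zeta auc i s r) = of_int v - of_nat (Suc k)"
proof -
  have "bidders (snd (zeta auc i s r) ! k) = {i}"
    using assms(3) by (simp add: zeta_bidders[OF assms(1,2)])
  then show ?thesis
    using zeta_outcome[OF assms(1,2)] zeta_reaches(3)[OF choosing_allowing(1)[OF assms(1)] assms(2)]
    by (simp add: auction_payoff_def)
qed

lemma payoff_one_rival:
  assumes "s \<in> strategies_choosing auc i h a" "r \<in> opp_allowing auc i h"
    and "a \<noteq> Bid" "card (rivals s r) = 1"
  shows "payoff auc i (zeta auc i s r) = 0"
proof -
  have b: "bidders (snd (zeta auc i s r) ! k) = rivals s r"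
    using assms(3) by (simp add: zeta_bidders[OF assms(1,2)])
  moreover have "rivals s r \<noteq> {}" using assms(4) by auto
  ultimately show ?thesis
    using zeta_outcome[OF assms(1,2)] assms(4) not_in_rivals[of s r]
    by (simp add: auction_payoff_def)
qed

lemma not_assigned_next:
  assumes "s \<in> strategies_choosing auc i h a" "r \<in> opp_allowing auc i h"
    and "\<not> card (bidders (snd (zeta auc i s r) ! k)) \<le> 1"
  shows "\<not> assigned (take (Suc k) (snd (zeta auc i s r)))"
  using zeta_reaches[OF choosing_allowing(1)[OF assms(1)] assms(2)] assms(3)
  by (auto simp: assigned_iff less_Suc_eq)

text \<open>A single rival wins at once; several rivals carry the auction on without
  \<open>i\<close>.\<close>

lemma payoff_Leave:
  assumes s: "s \<in> strategies_choosing auc i h Leave" and r: "r \<in> opp_allowing auc i h"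
    and "rivals s r \<noteq> {}"
  shows "payoff auc i (zeta auc i s r) = 0"
proof (cases "card (rivals s r) \<le> 1")
  case True
  then have "card (rivals s r) = 1" using assms(3) by (simp add: le_Suc_eq)
  then show ?thesis using payoff_one_rival[OF s r] by simp
next
  case False
  then have "\<not> assigned (take (Suc k) (snd (zeta auc i s r)))"
    using not_assigned_next[OF s r] by (simp add: zeta_bidders[OF s r])
  moreover have "has_left (take (Suc k) (snd (zeta auc i s r))) i"
    using zeta_own_action[OF s r] zeta_reaches(4)[OF choosing_allowing(1)[OF s] r] next_stage
    by (auto simp: has_left_iff intro!: exI[of _ k])
  ultimately show ?thesis
    using payoff_left[OF zeta_hists_at[OF choosing_allowing(1)[OF s] r]] by blast
qed

lemma payoff_above_valuation:
  assumes "s \<in> strategies_choosing auc i h a" "r \<in> opp_allowing auc i h" "v \<le> int (Suc k)"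
  shows "payoff auc i (zeta auc i s r) \<le> 0"
  using payoff_nonpos[of k "zeta auc i s r" i] assms(3)
    zeta_reaches[OF choosing_allowing(1)[OF assms(1)] assms(2)] by simp

lemma payoff_bid_then_leave:
  assumes s: "deviation t Bid (\<lambda>_. Leave) \<in> strategies_choosing auc i h Bid"
    and r: "r \<in> opp_allowing auc i h" and rv: "rivals (deviation t Bid (\<lambda>_. Leave)) r \<noteq> {}"
    and v: "int (Suc k) < v"
  shows "0 \<le> payoff auc i (zeta auc i (deviation t Bid (\<lambda>_. Leave)) r)"
proof (rule payoff_leave[where m = "Suc k" and n = T])
  let ?s = "deviation t Bid (\<lambda>_. Leave)"
  have ss: "?s \<in> strategies_allowing auc i h" "?s \<in> strategies auc i"
    using choosing_allowing[OF s] by blast+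
  show "zeta auc i ?s r \<in> hists_at auc T" using zeta_hists_at[OF ss(1) r] .
  show "\<not> assigned (take (Suc k) (snd (zeta auc i ?s r)))"
    using rv not_in_rivals[of ?s r] by (intro not_assigned_next[OF s r]) (simp add: zeta_bidders[OF s r])
  show "Suc k < T" using next_stage .
  have ro: "r \<in> opp_strategies auc i" using opp_allowingD(1)[OF hist r] .
  show "(snd (zeta auc i ?s r) ! Suc k) i = Leave"
    using deviation_Leave_after[OF ro, of "Suc k" t Bid] next_stage
    unfolding zeta_play by (simp add: nth_play_own)
  \<comment> \<open>Here integrality of valuations is used: a price strictly below \<open>v\<close>
    leaves room for one more increment.\<close>
  show "int (Suc (Suc k)) \<le> fst (zeta auc i ?s r) i"
    using v zeta_reaches(3)[OF ss(1) r] by simp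
qed

section \<open>Local dominance of bidding and of leaving\<close>

lemma Max_payoff_le_Min_payoff:
  assumes "s \<in> strategies_choosing auc i h a" "s' \<in> strategies_choosing auc i h a'"
    and "R \<subseteq> opp_allowing auc i h" "R \<noteq> {}"
    and "\<And>r. r \<in> R \<Longrightarrow> payoff auc i (zeta auc i s r) \<le> c"
    and "\<And>r. r \<in> R \<Longrightarrow> c \<le> payoff auc i (zeta auc i s' r)"
  shows "Max ((\<lambda>r. payoff auc i (zeta auc i s r)) ` R)
    \<le> Min ((\<lambda>r. payoff auc i (zeta auc i s' r)) ` R)"
  using assms by (intro Max_image_le_Min_image finite_payoffs_allowing)

text \<open>The continuing cell forces \<open>a = Wait\<close> and uses the copied continuation. All
  other nonempty cells consist of opponents for whom \<open>a\<close> ends, where bidding once and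
  then leaving is enough.\<close>

lemma locally_dominates_Bid:
  assumes v: "int (Suc k) < v" and a: "a \<noteq> Bid"
  shows "locally_dominates auc i h Bid a"
  unfolding locally_dominates_def
proof (intro ballI impI)
  fix R s
  assume R: "R \<in> local_partition auc i h Bid a" "R \<noteq> {}" and s: "s \<in> strategies_choosing auc i h a"
  have bid: "Bid \<in> acts auc i h"
    using unassigned not_left by (simp add: acts_infoset[OF hist] auction_avail_def)
  have RA: "R \<subseteq> opp_allowing auc i h"
    using R opp_ending_allowing unfolding local_partition_def opp_continuing_def by blast
  let ?sL = "deviation s Bid (\<lambda>_. Leave)"
  have sL: "?sL \<in> strategies_choosing auc i h Bid" using deviation_choosing[OF s bid] .
  have riv: "rivals ?sL r = rivals s r" if "r \<in> opp_allowing auc i h" for r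
    using rivals_eq[OF s sL that] .
  have E_Bid: "r \<in> opp_ending auc i h Bid \<longleftrightarrow> rivals s r = {}"
    if "r \<in> opp_allowing auc i h" for r
    using opp_ending_rivals[OF sL that] riv[OF that] by simp
  have E_a: "r \<in> opp_ending auc i h a \<longleftrightarrow> a = Leave \<or> card (rivals s r) \<le> 1"
    if "r \<in> opp_allowing auc i h" for r
    using opp_ending_rivals[OF s that] a by simp
  \<comment> \<open>Whoever lets a bid win at once lets every other action end too; the cell where
    \<open>Bid\<close> alone ends is therefore empty.\<close>
  have sub: "opp_ending auc i h Bid \<subseteq> opp_ending auc i h a"
  proof
    fix r assume r: "r \<in> opp_ending auc i h Bid"
    then have "r \<in> opp_allowing auc i h" by (rule opp_ending_allowing)
    then show "r \<in> opp_ending auc i h a" using r E_a E_Bid by simp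
  qed
  show "\<exists>s'\<in>strategies_choosing auc i h Bid. mimics auc i h R s' s \<and>
      (R \<noteq> opp_continuing auc i h Bid a \<longrightarrow>
         Max ((\<lambda>r. payoff auc i (zeta auc i s r)) ` R)
           \<le> Min ((\<lambda>r. payoff auc i (zeta auc i s' r)) ` R)) \<and>
      (R = opp_continuing auc i h Bid a \<longrightarrow>
         (\<forall>r\<in>R. outcome auc i (zeta auc i s' r) = outcome auc i (zeta auc i s r)))"
  proof (cases "R = opp_continuing auc i h Bid a")
    case True
    have many: "\<not> (a = Leave \<or> card (rivals s r) \<le> 1)" if "r \<in> R" for r
      using that True E_a[of r] unfolding opp_continuing_def by blast
    then have two: "2 \<le> card (rivals s r)" if "r \<in> R" for r
      using that by fastforce
    \<comment> \<open>\<open>Leave\<close> ends for all opponents, so a nonempty continuing cell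
      rules it out.\<close>
    have "a \<noteq> Leave" using many R(2) by blast
    then have sW: "s \<in> strategies_choosing auc i h Wait" using s a by (cases a) simp_all
    let ?s' = "deviation s Bid (waiting_plan s)"
    have copy: "contested k i (play auc i ?s' r n)" "(snd (play auc i ?s' r n) ! k) i = Bid"
      "play auc i s r n = wait_at k i (play auc i ?s' r n)"
      "n < T \<Longrightarrow> ?s' (infoset auc i (play auc i ?s' r n)) = s (infoset auc i (play auc i s r n))"
      if "r \<in> R" "k < n" "n \<le> T" for r n
      using play_waiting_plan[OF sW bid _ _ that(2,3)] that(1) two RA unfolding rivals_def by blast+
    have "mimics auc i h R ?s' s"
      using copy(4) by (intro mimicsI[OF hist]) simp
    moreover have "outcome auc i (zeta auc i ?s' r) = outcome auc i (zeta auc i s r)" if "r \<in> R" for r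
      using copy[OF that, of T] next_stage unfolding zeta_play
      by (simp add: auction_outcome_wait_at)
    ultimately show ?thesis
      using True deviation_choosing[OF s bid] by blast
  next
    case False
    then have RE: "R \<subseteq> opp_ending auc i h a"
      and R_cases: "R \<subseteq> opp_ending auc i h Bid \<or> R \<inter> opp_ending auc i h Bid = {}"
      using R sub unfolding local_partition_def by blast+
    have "Max ((\<lambda>r. payoff auc i (zeta auc i s r)) ` R)
        \<le> Min ((\<lambda>r. payoff auc i (zeta auc i ?sL r)) ` R)"
      using R_cases
    proof
      assume RB: "R \<subseteq> opp_ending auc i h Bid"
      show ?thesis
      \<comment> \<open>The threshold is the payoff of the bid itself, and it is positive, so it
        also bounds any lottery at this price.\<close>
      proof (rule Max_payoff_le_Min_payoff[OF s sL RA R(2), where c = "of_int v - of_nat (Suc k)"])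
        fix r assume "r \<in> R"
        then have r: "r \<in> opp_allowing auc i h" "rivals s r = {}" using RB RA E_Bid by blast+
        show "payoff auc i (zeta auc i s r) \<le> of_int v - of_nat (Suc k)"
          using payoff_no_bid(2)[OF s r(1) a r(2)] v by simp
        show "of_int v - of_nat (Suc k) \<le> payoff auc i (zeta auc i ?sL r)"
          using payoff_sole_bidder[OF sL r(1)] r(2) riv[OF r(1)] by simp
      qed
    next
      assume RB: "R \<inter> opp_ending auc i h Bid = {}"
      show ?thesis
      \<comment> \<open>Some rival bids against every element of \<open>R\<close>: an ending action
        other than \<open>Bid\<close> then forgoes the object.\<close>
      proof (rule Max_payoff_le_Min_payoff[OF s sL RA R(2), where c = 0])
        fix r assume rR: "r \<in> R"
        then have r: "r \<in> opp_allowing auc i h" "rivals s r \<noteq> {}" using RB RA E_Bid by blast+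
        have e: "a = Leave \<or> card (rivals s r) \<le> 1" using rR RE E_a[OF r(1)] by blast
        show "payoff auc i (zeta auc i s r) \<le> 0"
        proof (cases "a = Leave")
          case True
          then show ?thesis using payoff_Leave[of s r] s r by simp
        next
          case False
          then have "card (rivals s r) = 1" using e r(2) by (simp add: le_Suc_eq)
          then show ?thesis using payoff_one_rival[OF s r(1) a] by simp
        qed
        show "0 \<le> payoff auc i (zeta auc i ?sL r)"
          using payoff_bid_then_leave[OF sL r(1) _ v] r(2) riv[OF r(1)] by simp
      qed
    qed
    then show ?thesis using sL mimics_Leave_deviation[OF s RE] False by blast
  qed
qed

lemma locally_dominates_Leave:
  assumes v: "v = int (Suc k) \<or> v \<le> int (Suc k) \<and> a = Bid" and a: "a \<noteq> Leave"
  shows "locally_dominates auc i h Leave a"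
  unfolding locally_dominates_def
proof (intro ballI impI)
  fix R s
  assume R: "R \<in> local_partition auc i h Leave a" "R \<noteq> {}"
    and s: "s \<in> strategies_choosing auc i h a"
  let ?s' = "deviation s Leave (\<lambda>_. Leave)"
  have s': "?s' \<in> strategies_choosing auc i h Leave"
    using deviation_choosing[OF s Leave_acts[OF h_infoset]] .
  have E_Leave: "opp_ending auc i h Leave = opp_allowing auc i h"
    using opp_ending_rivals[OF s'] opp_ending_allowing by blast
  have riv: "rivals ?s' r = rivals s r" if "r \<in> opp_allowing auc i h" for r
    using rivals_eq[OF s s' that] .
  have RA: "R \<subseteq> opp_allowing auc i h" and cont: "R \<noteq> opp_continuing auc i h Leave a"
    and R_cases: "R \<subseteq> opp_ending auc i h a \<or> R \<inter> opp_ending auc i h a = {}"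
    using R E_Leave opp_ending_allowing unfolding local_partition_def opp_continuing_def by blast+
  have le: "v \<le> int (Suc k)" using v by auto
  have "mimics auc i h R ?s' s"
    using s' first_active_after_Leave unfolding mimics_def strategies_choosing_def by simp
  moreover have "Max ((\<lambda>r. payoff auc i (zeta auc i s r)) ` R)
      \<le> Min ((\<lambda>r. payoff auc i (zeta auc i ?s' r)) ` R)"
  proof (cases "v = int (Suc k) \<or> R \<inter> opp_ending auc i h a = {}")
    \<comment> \<open>Only a lottery without rivals could make leaving worth less than
      \<open>0\<close>. Its value is exactly \<open>0\<close> when the price equals
      \<open>v\<close>, and such opponents are absent when no element of \<open>R\<close> ends
      \<open>a\<close>.\<close>
    case True
    show ?thesis
    proof (rule Max_payoff_le_Min_payoff[OF s s' RA R(2), where c = 0])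
      fix r assume rR: "r \<in> R"
      then have r: "r \<in> opp_allowing auc i h" using RA by blast
      show "payoff auc i (zeta auc i s r) \<le> 0" using payoff_above_valuation[OF s r le] .
      show "0 \<le> payoff auc i (zeta auc i ?s' r)"
      proof (cases "rivals s r = {}")
        case True
        then have "r \<in> opp_ending auc i h a" using opp_ending_rivals[OF s r] by simp
        then have "v = int (Suc k)" using \<open>v = int (Suc k) \<or> R \<inter> opp_ending auc i h a = {}\<close> rR by blast
        then show ?thesis using payoff_no_bid(1)[OF s' r] True riv[OF r] by simp
      next
        case False
        then show ?thesis using payoff_Leave[OF s' r] riv[OF r] by simp
      qed
    qed
  next
    case False
    then have aB: "a = Bid" and RE: "R \<subseteq> opp_ending auc i h a" using v R_cases by blast+
    show ?thesis
    \<comment> \<open>In this cell the bid wins for certain at the current price; as the price is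
      not below the valuation, no lottery at that price is worth less.\<close>
    proof (rule Max_payoff_le_Min_payoff[OF s s' RA R(2), where c = "of_int v - of_nat (Suc k)"])
      fix r assume rR: "r \<in> R"
      then have r: "r \<in> opp_allowing auc i h" "rivals s r = {}"
        using RA RE opp_ending_rivals[OF s, of r] aB by auto
      show "payoff auc i (zeta auc i s r) \<le> of_int v - of_nat (Suc k)"
        using payoff_sole_bidder[of s r] s aB r by simp
      show "of_int v - of_nat (Suc k) \<le> payoff auc i (zeta auc i ?s' r)"
        using payoff_no_bid(1)[OF s' r(1)] r(2) riv[OF r(1)] le by simp
    qed
  qed
  ultimately show "\<exists>s'\<in>strategies_choosing auc i h Leave. mimics auc i h R s' s \<and>
      (R \<noteq> opp_continuing auc i h Leave a \<longrightarrow>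
         Max ((\<lambda>r. payoff auc i (zeta auc i s r)) ` R)
           \<le> Min ((\<lambda>r. payoff auc i (zeta auc i s' r)) ` R)) \<and>
      (R = opp_continuing auc i h Leave a \<longrightarrow>
         (\<forall>r\<in>R. outcome auc i (zeta auc i s' r) = outcome auc i (zeta auc i s r)))"
    using s' cont by blast
qed

lemma locally_dominant_Bid: "int (Suc k) < v \<Longrightarrow> locally_dominant auc i h Bid"
  unfolding locally_dominant_def
  using locally_dominates_Bid unassigned not_left
  by (auto simp: acts_infoset[OF hist] auction_avail_def)

lemma locally_dominant_Leave:
  assumes "v = int (Suc k) \<or> v \<le> int (Suc k) \<and> \<not> waiting"
  shows "locally_dominant auc i h Leave"
  unfolding locally_dominant_def
proof (intro conjI ballI)
  show "Leave \<in> acts auc i h" using Leave_acts[OF h_infoset] .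
  fix a assume a: "a \<in> acts auc i h - {Leave}"
  then have "a = Bid \<or> waiting"
    by (auto simp: acts_infoset[OF hist] auction_avail_def split: if_splits)
  then show "locally_dominates auc i h Leave a"
    using assms a by (intro locally_dominates_Leave) auto
qed

end

context ascending_auction
begin

section \<open>Truthful bidding throughout the auction\<close>

lemma decision_node:
  assumes "h \<in> active_infosets auc i" "x \<in> h" "Suc (length (snd x)) < T"
  shows "h = infoset auc i x" "decision_node \<Theta> T waiting lot lpay i x"
proof -
  have h: "h \<in> infosets auc i" using assms(1) unfolding active_infosets_def by blast
  show eq: "h = infoset auc i x" using infosets_eq(1)[OF h assms(2)] .
  have x: "x \<in> hists auc" using infosets_eq(2)[OF h assms(2)] .
  show "decision_node \<Theta> T waiting lot lpay i x"
    using assms x active_infoset_iff[OF x, of i] unfolding eq by unfold_locales auto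
qed

lemma hists_valuation: "x \<in> hists auc \<Longrightarrow> fst x i < int T"
  using valuation_less by (simp add: hists_iff hists_at_iff)

lemma active_locally_dominant:
  assumes "h \<in> active_infosets auc i" "x \<in> h"
  shows "int (stage x) < fst x i \<Longrightarrow> locally_dominant auc i h Bid"
    and "int (stage x) = fst x i \<Longrightarrow> locally_dominant auc i h Leave"
proof -
  have "h \<in> infosets auc i" using assms(1) unfolding active_infosets_def by blast
  from hists_valuation[OF infosets_eq(2)[OF this assms(2)], of i]
  \<comment> \<open>Valuations lie below \<open>T\<close>, so a price not above the valuation leaves
    a further stage.\<close>
  have v: "int (stage x) \<le> fst x i \<Longrightarrow> Suc (length (snd x)) < T" by (simp add: stage_def)
  show "locally_dominant auc i h Bid" if "int (stage x) < fst x i"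
    using decision_node[OF assms] decision_node.locally_dominant_Bid[of \<Theta> T waiting lot lpay i x] v that
    by (simp add: stage_def)
  show "locally_dominant auc i h Leave" if "int (stage x) = fst x i"
    using decision_node[OF assms] decision_node.locally_dominant_Leave[of \<Theta> T waiting lot lpay i x] v that
    by (simp add: stage_def)
qed

text \<open>The test on \<open>Bid\<close> keeps the plan available at inactive information sets,
  where only \<open>Leave\<close> can be played.\<close>

definition truthful_plan where
  "truthful_plan i h =
     (if Bid \<in> acts auc i h \<and> (\<exists>x\<in>h. int (stage x) < fst x i) then Bid else Leave)"

lemma truthful_plan_infoset:
  assumes "x \<in> hists auc"
  shows "truthful_plan i (infoset auc i x) =
    (if Bid \<in> auction_avail waiting i x \<and> int (stage x) < fst x i then Bid else Leave)"
proof -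
  have "stage y = stage x \<and> fst y i = fst x i" if "y \<in> infoset auc i x" for y
    using mem_infosetD[OF that] infoset_length[OF assms that] by (auto simp: auction_indist_def stage_def)
  then have "(\<exists>y\<in>infoset auc i x. int (stage y) < fst y i) \<longleftrightarrow> int (stage x) < fst x i"
    using mem_infoset_self[OF assms, of i] by metis
  then show ?thesis unfolding truthful_plan_def acts_infoset[OF assms] by simp
qed

text \<open>The truthful strategy leaves as soon as the price is at least the valuation, so an
  active set that it reaches has a price up to the valuation or belongs to the first stage.\<close>

lemma locally_strategy_proof_auction: "locally_strategy_proof auc"
  unfolding locally_strategy_proof_def
proof (intro allI)
  fix i
  let ?s = "reduced_strategy auc i (truthful_plan i)"
  have s: "?s \<in> strategies auc i"
    by (rule reduced_strategy_strategies) (simp add: truthful_plan_def Leave_acts)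
  have "locally_dominant auc i h (the (?s h))"
    if h: "h \<in> active_infosets auc i" and sh: "?s \<in> strategies_allowing auc i h" for h
  proof -
    have hi: "h \<in> infosets auc i" using h unfolding active_infosets_def by blast
    obtain x where x: "x \<in> hists auc" "x \<in> h" "h = infoset auc i x" using infosetsE[OF hi] .
    have act: "\<not> assigned (snd x)" "\<not> has_left (snd x) i"
      using h active_infoset_iff[OF x(1)] x(3) by blast+
    have follows: "?s (infoset auc i (trunc j x)) = Some ((snd x ! j) i)" if "j < length (snd x)" for j
      using allowing_consistent[OF x(1) sh[unfolded x(3)] that] .
    have "?s h \<noteq> None"
      using strategies_defined[OF s hi x(2)] follows unfolding consistent_def by auto
    then have sh: "?s h = Some (truthful_plan i h)" by (rule reduced_strategy_eq)
    have plan: "truthful_plan i h = (if int (stage x) < fst x i then Bid else Leave)"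
      using act unfolding x(3) truthful_plan_infoset[OF x(1)] by (simp add: auction_avail_def)
    have first: "length (snd x) = 0 \<or> int (stage x) \<le> fst x i"
    proof (rule ccontr)
      assume c: "\<not> (length (snd x) = 0 \<or> int (stage x) \<le> fst x i)"
      \<comment> \<open>The previous stage: its price is one lower and by integrality was already at
        least the valuation, so the plan left there and \<open>h\<close> could not be
        active.\<close>
      define j where "j = length (snd x) - 1"
      have j: "j < length (snd x)" using c unfolding j_def by simp
      have t: "trunc j x \<in> hists auc"
        using trunc_hists[of x auc "length (snd x)" j] j x(1) by (simp add: hists_iff)
      have "\<not> int (stage (trunc j x)) < fst x i" using c j unfolding j_def stage_def by auto
      then have "truthful_plan i (infoset auc i (trunc j x)) = Leave"
        unfolding truthful_plan_infoset[OF t] by simp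
      moreover have "?s (infoset auc i (trunc j x)) =
          Some (truthful_plan i (infoset auc i (trunc j x)))"
        using follows[OF j] by (intro reduced_strategy_eq) simp
      ultimately have "(snd x ! j) i = Leave" using follows[OF j] by simp
      then have "has_left (snd x) i" using j by (auto simp: has_left_iff)
      then show False using act by blast
    qed
    show ?thesis
    proof (cases "int (stage x) \<le> fst x i")
      case True
      then show ?thesis
        using active_locally_dominant[OF h x(2)] sh plan by (cases "int (stage x) = fst x i") auto
    next
      case False
      then have x0: "length (snd x) = 0" using first by blast
      then have low: "fst x i < 1" using False by (simp add: stage_def)
      have "fst x \<in> \<Theta>" using x(1) by (simp add: hists_iff hists_at_iff)
      \<comment> \<open>A valuation below the first price excludes the waiting option, so
        \<open>Bid\<close> is the only alternative that \<open>Leave\<close> has to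
        dominate.\<close>
      then have "\<not> waiting" using valuation_ge_1[of "fst x" i] low by auto
      moreover have "Suc (length (snd x)) < T" using two_stages x0 by simp
      ultimately show ?thesis
        using decision_node[OF h x(2)] sh plan False
          decision_node.locally_dominant_Leave[of \<Theta> T waiting lot lpay i x]
        by (simp add: stage_def)
    qed
  qed
  then show "\<exists>s\<in>strategies auc i. \<forall>h\<in>active_infosets auc i.
      s \<in> strategies_allowing auc i h \<longrightarrow> locally_dominant auc i h (the (s h))"
    using s by blast
qed

end

theorem proposition4:
  fixes \<Theta> :: "('i::finite \<Rightarrow> int) set"
    and T :: nat
    and waiting :: bool
    and lot :: "nat \<Rightarrow> 'i set \<Rightarrow> 'i \<Rightarrow> real"
    and lpay :: "'i \<Rightarrow> int \<Rightarrow> nat \<Rightarrow> real \<Rightarrow> real"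
  assumes "finite \<Theta>" and "\<Theta> \<noteq> {}"
    and "\<And>\<theta> i. \<theta> \<in> \<Theta> \<Longrightarrow> \<theta> i < int T"
    and "2 \<le> T"
    and "\<And>\<theta> i. waiting \<Longrightarrow> \<theta> \<in> \<Theta> \<Longrightarrow> 1 \<le> \<theta> i"
    and "\<And>p R i. i \<in> R \<Longrightarrow> 0 \<le> lot p R i"
    and "\<And>p R. R \<noteq> {} \<Longrightarrow> (\<Sum>i\<in>R. lot p R i) = 1"
    and "\<And>i v p q. 0 \<le> q \<Longrightarrow> q \<le> 1 \<Longrightarrow>
           min 0 (of_int v - of_nat p) \<le> lpay i v p q \<and> lpay i v p q \<le> max 0 (of_int v - of_nat p)"
  shows "locally_strategy_proof (auction waiting \<Theta> T lot lpay) \<and>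
    (\<forall>i. \<forall>h\<in>active_infosets (auction waiting \<Theta> T lot lpay) i. \<forall>x\<in>h.
       (int (stage x) < fst x i \<longrightarrow>
          locally_dominant (auction waiting \<Theta> T lot lpay) i h Bid) \<and>
       (int (stage x) = fst x i \<longrightarrow>
          locally_dominant (auction waiting \<Theta> T lot lpay) i h Leave))"
proof -
  interpret ascending_auction \<Theta> T waiting lot lpay
    using assms by unfold_locales
  show ?thesis
    using locally_strategy_proof_auction active_locally_dominant by blast
qed

end
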